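(* Let $p\ge 2$, $-\infty\le a<b\le+\infty$, and let $h:(0,\infty)\to(0,\infty)$ be a continuous function which is integrable in every neighborhood of zero. Let $H(x):=\int_0^x h(\tau)\,d\tau$ for $x>0$, let $\tilde H$ be its continuous extension to $[0,\infty)$, so that $\tilde H(0)=0$, and let $\mathcal{T}_h:=H/h:(0,\infty)\to(0,\infty)$. Let $\tilde{\mathcal{R}}^0(a,b)$ be the set of all $f\in W^{2,1}_{loc}((a,b))$ such that $$\liminf_{R\nearrow b}|f'(R)|^{p-2}f'(R)\,\mathrm{sign}f(R)\,\tilde H(|f(R)|)\le 0\quad\text{and}\quad\limsup_{r\searrow a}|f'(r)|^{p-2}f'(r)\,\mathrm{sign}f(r)\,\tilde H(|f(r)|)\ge 0 .$$ Then for every $f\in\tilde{\mathcal{R}}^0(a,b)$, $$\int_{(a,b)\cap\{x:f(x)\ne 0\}}|f'(x)|^p h(|f(x)|)\,dx\le\left(\sqrt{p-1}\right)^p\int_{(a,b)\cap\{x:f(x)\ne 0\}}\left|f''(x)\,\mathcal{T}_h(|f(x)|)\right|^{\frac p2}h(|f(x)|)\,dx .$$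
   Context: Here $f\in W^{2,1}_{loc}$ is identified with its $C^1$ representative whose derivative $f'$ is locally absolutely continuous; $f''$ is the a.e. defined second derivative. "Integrable in every neighborhood of zero" means integrable on $(0,\epsilon)$ for every $0<\epsilon<\infty$. Functions are real valued, and integrals of nonnegative functions are taken in $[0,+\infty]$. *)

theory Defs
  imports "HOL-Analysis.Analysis"
begin

text \<open>Absolute continuity in the usual epsilon-delta sense: \<open>n\<close> non-overlapping intervals
  \<open>{u i..v i}\<close> contained in \<open>I\<close>, degenerate ones allowed (they contribute 0 to both sums).\<close>

definition abs_continuous_on :: "real set \<Rightarrow> (real \<Rightarrow> real) \<Rightarrow> bool" where
  "abs_continuous_on I g \<longleftrightarrow>
     (\<forall>\<epsilon>>0. \<exists>\<delta>>0. \<forall>(n::nat) u v.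
        (\<forall>i<n. u i \<le> v i \<and> {u i..v i} \<subseteq> I) \<and>
        disjoint_family_on (\<lambda>i. {u i<..<v i}) {..<n} \<and>
        (\<Sum>i<n. v i - u i) < \<delta>
        \<longrightarrow> (\<Sum>i<n. \<bar>g (v i) - g (u i)\<bar>) < \<epsilon>)"

definition loc_abs_continuous_on :: "real set \<Rightarrow> (real \<Rightarrow> real) \<Rightarrow> bool" where
  "loc_abs_continuous_on I g \<longleftrightarrow> (\<forall>c d. {c..d} \<subseteq> I \<longrightarrow> abs_continuous_on {c..d} g)"

text \<open>\<open>W\<^sup>2\<^sup>,\<^sup>1\<close> local Sobolev functions on an open interval \<open>I\<close>, given by their \<open>C\<^sup>1\<close>
  representatives. Values outside \<open>I\<close> are irrelevant. The second derivative, which exists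
  almost everywhere on \<open>I\<close>, is \<open>deriv (deriv f)\<close>.\<close>

definition W21_loc :: "real set \<Rightarrow> (real \<Rightarrow> real) set" where
  "W21_loc I = {f. (\<forall>x\<in>I. f differentiable (at x)) \<and> continuous_on I (deriv f) \<and>
                   loc_abs_continuous_on I (deriv f)}"

definition H_fun :: "(real \<Rightarrow> real) \<Rightarrow> real \<Rightarrow> real" where
  "H_fun h x = (LBINT \<tau>:{0<..<x}. h \<tau>)"

text \<open>The continuous extension of \<^term>\<open>H_fun h\<close> from the positive half-line to 0.\<close>

definition H_ext :: "(real \<Rightarrow> real) \<Rightarrow> real \<Rightarrow> real" where
  "H_ext h x = (if x > 0 then H_fun h x else 0)"

definition T_fun :: "(real \<Rightarrow> real) \<Rightarrow> real \<Rightarrow> real" where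
  "T_fun h x = H_fun h x / h x"

text \<open>At \<open>p = 2\<close> and \<open>f' = 0\<close> the convention \<open>0 powr 0 = 0\<close> is harmless, since the power is
  multiplied by \<open>f'\<close>.\<close>

definition boundary_term ::
    "real \<Rightarrow> (real \<Rightarrow> real) \<Rightarrow> (real \<Rightarrow> real) \<Rightarrow> real \<Rightarrow> real" where
  "boundary_term p h f x =
     \<bar>deriv f x\<bar> powr (p - 2) * deriv f x * sgn (f x) * H_ext h \<bar>f x\<bar>"

text \<open>The endpoints may be infinite, so the one-sided limits are taken in \<^typ>\<open>ereal\<close>. Since
  \<open>a < b\<close>, near the endpoints the filters only see finite points of \<open>(a, b)\<close>.\<close>

definition R0_tilde ::
    "real \<Rightarrow> (real \<Rightarrow> real) \<Rightarrow> ereal \<Rightarrow> ereal \<Rightarrow> (real \<Rightarrow> real) set" where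
  "R0_tilde p h a b = {f \<in> W21_loc (einterval a b).
     Liminf (at_left b) (\<lambda>R. ereal (boundary_term p h f (real_of_ereal R))) \<le> 0 \<and>
     Limsup (at_right a) (\<lambda>r. ereal (boundary_term p h f (real_of_ereal r))) \<ge> 0}"

end

theory Submission
  imports Defs
begin

text \<open>
  Write \<open>\<Phi>(y) = |y|\<^sup>p\<^sup>-\<^sup>2 y\<close> and let \<open>K\<close> be the odd extension of \<open>H\<close>, so that the boundary term is
  \<open>B = \<Phi>(f') K(f)\<close>. Formally \<open>B' = |f'|\<^sup>p h(|f|) + (p - 1) |f'|\<^sup>p\<^sup>-\<^sup>2 f'' K(f)\<close>, and Young's inequality
  with exponents \<open>p / (p - 2)\<close> and \<open>p / 2\<close> (not needed when \<open>p = 2\<close>), applied pointwise with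
  \<open>H = T h\<close>, bounds \<open>p / 2\<close> times the modulus of the last term by
  \<open>(p / 2 - 1) |f'|\<^sup>p h(|f|) + (p - 1)\<^sup>p\<^sup>/\<^sup>2 |f'' T(|f|)|\<^sup>p\<^sup>/\<^sup>2 h(|f|)\<close>. The exponents are such that
  exactly one copy of \<open>|f'|\<^sup>p h(|f|)\<close> survives on the left, so integrating over \<open>[r, R]\<close> yields the
  claim with the error \<open>p / 2 (B(R) - B(r))\<close>. The hypothesis on \<open>f\<close> ensures that this error
  is at most any given positive number for suitable \<open>r\<close> near \<open>a\<close> and \<open>R\<close> near \<open>b\<close>.

  Since \<open>h\<close> may blow up at \<open>0\<close>, it is not clear in advance that \<open>B\<close> is absolutely continuous or that
  the integral to be absorbed is finite. Therefore \<open>h\<close> is first multiplied by a nondecreasing cutoff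
  that vanishes near \<open>0\<close>. The truncated weight is continuous on the whole line, and because the
  cutoff is nondecreasing the truncated quotient \<open>H / h\<close> is dominated by the original one. The
  resulting inequality (\<open>truncated_estimate\<close>) involves only finite quantities, and Fatou's lemma
  removes the cutoff (\<open>compact_interval_estimate\<close>).

  Two facts about absolutely continuous functions on the line carry the integration of \<open>B'\<close>: they
  are differentiable almost everywhere (\<open>loc_abs_continuous_on_differentiable_ae\<close>), and they are
  Henstock-Kurzweil integrals of their derivatives (\<open>abs_continuous_has_integral_derivative\<close>). The
  first is proved by a covering argument for functions of bounded variation: take a division
  whose variation is almost the total variation. Disjoint intervals on which the function moves, at
  a definite rate, against its increment over the cell of the division containing them can be
  inserted into the division and then increase its variation by an amount proportional to their
  total length, which must therefore be small. Vitali's theorem turns this into smallness of the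
  set of points where the difference quotients oscillate.
\<close>

section \<open>Divisions and variation\<close>

text \<open>The increment of \<open>g\<close> over a compact interval, read off from the interval as a set.\<close>

definition increment :: "(real \<Rightarrow> real) \<Rightarrow> real set \<Rightarrow> real" where
  "increment g K = g (Sup K) - g (Inf K)"

lemma increment_Icc [simp]: "u \<le> v \<Longrightarrow> increment g {u..v} = g v - g u"
  by (simp add: increment_def)

lemma division_member_Icc:
  assumes "D division_of {c..d::real}" "K \<in> D"
  obtains u v where "K = {u..v}" "u \<le> v" "c \<le> u" "v \<le> d"
proof -
  obtain u v where "K = cbox u v" "K \<noteq> {}" "K \<subseteq> {c..d}"
    using assms division_ofD(2-4)[OF assms(1)] by metis
  then show thesis using that[of u v] by auto
qed

lemma sum_increment_division:
  assumes "D division_of {c..d::real}" "c \<le> d"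
  shows "(\<Sum>K\<in>D. increment g K) = g d - g c"
proof -
  let ?p = "(\<lambda>K. (Inf K, K)) ` D"
  have "?p tagged_division_of {c..d}"
  proof (rule tagged_division_ofI)
    show "finite ?p" using assms(1) by auto
    show "x \<in> K" if xK: "(x, K) \<in> ?p" for x K
    proof -
      have "K \<in> D" using xK by auto
      then obtain u v where "K = {u..v}" "u \<le> v"
        using division_member_Icc[OF assms(1)] by metis
      then show ?thesis using xK by auto
    qed
    show "K \<subseteq> {c..d}" if "(x, K) \<in> ?p" for x K
      using that division_ofD(2)[OF assms(1)] by blast
    show "\<exists>a b. K = cbox a b" if "(x, K) \<in> ?p" for x K
      using that division_ofD(4)[OF assms(1)] by blast
    show "interior K1 \<inter> interior K2 = {}"
      if "(x1, K1) \<in> ?p" "(x2, K2) \<in> ?p" "(x1, K1) \<noteq> (x2, K2)" for x1 K1 x2 K2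
      using that division_ofD(5)[OF assms(1), of K1 K2] by blast
    show "\<Union>{K. \<exists>x. (x, K) \<in> ?p} = {c..d}"
    proof -
      have "{K. \<exists>x. (x, K) \<in> ?p} = D" by auto
      then show ?thesis using division_ofD(6)[OF assms(1)] by simp
    qed
  qed
  from additive_tagged_division_1[OF assms(2) this, of g]
  have "(\<Sum>(x, K)\<in>?p. increment g K) = g d - g c" by (simp add: increment_def)
  also have "(\<Sum>(x, K)\<in>?p. increment g K) = (\<Sum>K\<in>D. increment g K)"
    by (subst sum.reindex) (auto simp: inj_on_def)
  finally show ?thesis .
qed

lemma extend_disjoint_intervals:
  fixes c d :: real and F :: "(real \<times> real) set"
  assumes "finite F" and F: "\<And>u v. (u, v) \<in> F \<Longrightarrow> u < v \<and> c \<le> u \<and> v \<le> d"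
    and disj: "pairwise (\<lambda>p q. disjnt {fst p..snd p} {fst q..snd q}) F"
  obtains q where "q division_of {c..d}" "(\<lambda>(u, v). {u..v}) ` F \<subseteq> q"
    "inj_on (\<lambda>(u, v). {u..v}) F"
proof -
  let ?I = "\<lambda>(u, v). {u..v::real}"
  have inj: "inj_on ?I F"
    using F by (fastforce simp: inj_on_def)
  have "?I ` F division_of \<Union>(?I ` F)"
  proof (rule division_ofI)
    show "finite (?I ` F)" using \<open>finite F\<close> by simp
    show "K \<noteq> {}" if "K \<in> ?I ` F" for K using that F by force
    show "\<exists>a b. K = cbox a b" if "K \<in> ?I ` F" for K using that by auto
    show "interior K1 \<inter> interior K2 = {}"
      if K: "K1 \<in> ?I ` F" "K2 \<in> ?I ` F" "K1 \<noteq> K2" for K1 K2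
    proof -
      obtain p q where "p \<in> F" "q \<in> F" and pq: "K1 = ?I p" "K2 = ?I q" using K by auto
      with K have "p \<noteq> q" by auto
      with \<open>p \<in> F\<close> \<open>q \<in> F\<close> disj have "disjnt K1 K2"
        unfolding pq pairwise_def by (auto simp: case_prod_beta)
      then show ?thesis using interior_subset unfolding disjnt_def by blast
    qed
  qed auto
  moreover have "\<Union>(?I ` F) \<subseteq> cbox c d" using F by fastforce
  ultimately obtain q where "?I ` F \<subseteq> q" "q division_of cbox c d"
    by (rule partial_division_extend_interval)
  with inj show thesis by (intro that[of q]) auto
qed

lemma sum_disjoint_intervals_le:
  fixes \<phi> :: "real set \<Rightarrow> real"
  assumes "q division_of {c..d}" "(\<lambda>(u, v). {u..v}) ` F \<subseteq> q" "inj_on (\<lambda>(u, v). {u..v}) F"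
    and "\<And>K. K \<in> q \<Longrightarrow> 0 \<le> \<phi> K"
  shows "(\<Sum>(u, v)\<in>F. \<phi> {u..v}) \<le> sum \<phi> q"
proof -
  have "(\<Sum>(u, v)\<in>F. \<phi> {u..v}) = sum \<phi> ((\<lambda>(u, v). {u..v}) ` F)"
    by (subst sum.reindex[OF assms(3)]) (simp add: case_prod_beta comp_def)
  also have "\<dots> \<le> sum \<phi> q"
    using assms by (intro sum_mono2) auto
  finally show ?thesis .
qed

text \<open>The form in which Vitali's covering theorem is used: if \<open>J\<close> contains arbitrarily short intervals
  around each point of \<open>E\<close>, and finite disjoint subfamilies of \<open>J\<close> have total length at most \<open>B\<close>, then
  \<open>E\<close> has outer measure at most \<open>B\<close>. No measurability of \<open>E\<close> is needed.\<close>

lemma vitali_measure_bound: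
  fixes J :: "(real \<times> real) set" and E :: "real set"
  assumes J: "\<And>u v. (u, v) \<in> J \<Longrightarrow> u < v"
    and cov: "\<And>x e. x \<in> E \<Longrightarrow> e > 0 \<Longrightarrow> \<exists>u v. (u, v) \<in> J \<and> x \<in> {u..v} \<and> v - u < e"
    and bound: "\<And>F. finite F \<Longrightarrow> F \<subseteq> J \<Longrightarrow>
       pairwise (\<lambda>p q. disjnt {fst p..snd p} {fst q..snd q}) F \<Longrightarrow> (\<Sum>(u, v)\<in>F. v - u) \<le> B"
  obtains T where "E \<subseteq> T" "T \<in> lmeasurable" "measure lebesgue T \<le> B"
proof -
  define a r where "a = (\<lambda>p::real \<times> real. (fst p + snd p) / 2)" 
    and "r = (\<lambda>p::real \<times> real. (snd p - fst p) / 2)"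
  have cb: "cball (a p) (r p) = {fst p..snd p}" for p
    by (simp add: cball_eq_atLeastAtMost a_def r_def field_simps)
  obtain C where C: "countable C" "C \<subseteq> J"
    "pairwise (\<lambda>i j. disjnt (cball (a i) (r i)) (cball (a j) (r j))) C"
    "negligible (E - (\<Union>i\<in>C. cball (a i) (r i)))"
  proof (rule Vitali_covering_theorem_cballs[of J r E a])
    show "0 < r i" if "i \<in> J" for i using J[of "fst i" "snd i"] that by (simp add: r_def)
    show "\<exists>i. i \<in> J \<and> x \<in> cball (a i) (r i) \<and> r i < e" if x: "x \<in> E" "0 < e" for x e
    proof -
      obtain u v where uv: "(u, v) \<in> J" "x \<in> {u..v}" "v - u < e" using cov[OF x] by blast
      then have "r (u, v) < e" using J[OF uv(1)] by (simp add: r_def)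
      with uv show ?thesis unfolding cb by force
    qed
  qed
  let ?U = "\<Union>p\<in>C. {fst p..snd p}"
  have fin: "measure lebesgue (\<Union>p\<in>F. {fst p..snd p}) \<le> B" if F: "F \<subseteq> C" "finite F" for F
  proof -
    have "measure lebesgue (\<Union>p\<in>F. {fst p..snd p}) \<le> (\<Sum>p\<in>F. measure lebesgue {fst p..snd p})"
      by (rule measure_UNION_le) (use F in auto)
    also have "\<dots> = (\<Sum>(u, v)\<in>F. v - u)"
      using F C(2) J by (intro sum.cong) (force simp: case_prod_beta)+
    also have "\<dots> \<le> B"
      using F C(2,3) by (intro bound) (auto simp: cb intro: pairwise_subset)
    finally show ?thesis .
  qed
  have U: "?U \<in> lmeasurable" "measure lebesgue ?U \<le> B"
    using fmeasurable_UN_bound[OF C(1) _ fin] measure_UN_bound[OF C(1) _ fin] by auto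
  let ?N = "E - ?U"
  have N: "negligible ?N" using C(4) unfolding cb .
  show thesis
  proof (rule that[of "?U \<union> ?N"])
    show "?U \<union> ?N \<in> lmeasurable"
      using U(1) N negligible_imp_measurable by (intro fmeasurable.Un) auto
    have "measure lebesgue (?U \<union> ?N) \<le> measure lebesgue ?U + measure lebesgue ?N"
      by (rule measure_Un_le) (use U(1) N negligible_imp_measurable in blast)+
    with U(2) N show "measure lebesgue (?U \<union> ?N) \<le> B" by (simp add: negligible_imp_measure0)
  qed auto
qed

text \<open>The variation of \<open>g\<close> on \<open>{c..d}\<close> is at most \<open>M\<close>.\<close>

definition bounded_var :: "(real \<Rightarrow> real) \<Rightarrow> real \<Rightarrow> real \<Rightarrow> real \<Rightarrow> bool" where
  "bounded_var g c d M \<longleftrightarrow> (\<forall>D. D division_of {c..d} \<longrightarrow> (\<Sum>K\<in>D. \<bar>increment g K\<bar>) \<le> M)"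

text \<open>Cells of two different local divisions can coincide only if they are degenerate, and then the
  increment vanishes; this is why the sums agree.\<close>

lemma refine_division:
  assumes D: "D division_of {c..d::real}" and q: "\<And>K. K \<in> D \<Longrightarrow> q K division_of K"
  shows "(\<Union>K\<in>D. q K) division_of {c..d}"
    and "(\<Sum>K\<in>(\<Union>K\<in>D. q K). \<bar>increment g K\<bar>) = (\<Sum>K\<in>D. \<Sum>L\<in>q K. \<bar>increment g L\<bar>)"
proof -
  have disj: "interior L1 \<inter> interior L2 = {}"
    if "K1 \<in> D" "K2 \<in> D" "L1 \<in> q K1" "L2 \<in> q K2" "L1 \<noteq> L2 \<or> K1 \<noteq> K2" for K1 K2 L1 L2
  proof (cases "K1 = K2")
    case True
    then show ?thesis using that division_ofD(5)[OF q[OF that(1)]] by auto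
  next
    case False
    then have "interior K1 \<inter> interior K2 = {}" using that D by auto
    moreover have "L1 \<subseteq> K1" "L2 \<subseteq> K2" using that q by auto
    ultimately show ?thesis using interior_mono by blast
  qed
  show "(\<Union>K\<in>D. q K) division_of {c..d}"
  proof (rule division_ofI)
    show "finite (\<Union>K\<in>D. q K)" using D q by auto
    show "K \<subseteq> {c..d}" if "K \<in> (\<Union>K\<in>D. q K)" for K
      using that division_ofD(2)[OF D] division_ofD(2)[OF q] by blast
    show "K \<noteq> {}" if "K \<in> (\<Union>K\<in>D. q K)" for K
      using that division_ofD(3)[OF q] by blast
    show "\<exists>a b. K = cbox a b" if "K \<in> (\<Union>K\<in>D. q K)" for K
      using that division_ofD(4)[OF q] by blast
    show "interior K1 \<inter> interior K2 = {}"
      if "K1 \<in> (\<Union>K\<in>D. q K)" "K2 \<in> (\<Union>K\<in>D. q K)" "K1 \<noteq> K2" for K1 K2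
      using that disj by (metis UN_E)
    show "\<Union>(\<Union>K\<in>D. q K) = {c..d}"
      using division_ofD(6)[OF D] division_ofD(6)[OF q] by blast
  qed
  have injq: "inj_on q D"
    by (rule inj_onI) (metis division_ofD(6) q)
  have "(\<Sum>K\<in>\<Union>(q ` D). \<bar>increment g K\<bar>) = (sum \<circ> sum) (\<lambda>K. \<bar>increment g K\<bar>) (q ` D)"
  proof (rule sum.Union_comp)
    show "\<forall>A\<in>q ` D. finite A" using q by auto
    fix A1 A2 L assume "A1 \<in> q ` D" "A2 \<in> q ` D" "A1 \<noteq> A2" and L: "L \<in> A1" "L \<in> A2"
    then obtain K1 K2 where K: "K1 \<in> D" "K2 \<in> D" "A1 = q K1" "A2 = q K2" "K1 \<noteq> K2" by auto
    then have "interior L = {}" using disj[of K1 K2 L L] L by auto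
    moreover obtain u v where "L = cbox u v" "L \<noteq> {}"
      using division_ofD(3,4)[OF q[OF K(1)], of L] L K by auto
    ultimately have "L = {u..u}" by (auto simp: cbox_interval)
    then show "\<bar>increment g L\<bar> = 0" by (simp add: increment_def)
  qed
  then show "(\<Sum>K\<in>(\<Union>K\<in>D. q K). \<bar>increment g K\<bar>) = (\<Sum>K\<in>D. \<Sum>L\<in>q K. \<bar>increment g L\<bar>)"
    by (simp add: sum.reindex[OF injq])
qed

text \<open>Here \<open>\<sigma>\<close> is the sign of the increment of \<open>g\<close> over the cell \<open>{c..d}\<close>. Over any division the numbers
  \<open>|\<Delta>| - \<sigma> \<Delta>\<close> are nonnegative, and an interval \<open>{u..v}\<close> of \<open>F\<close> contributes at least
  \<open>2 s (v - u)\<close> to their sum.\<close>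

lemma steep_opposite_increments_variation:
  fixes c d \<sigma> s :: real and F :: "(real \<times> real) set"
  assumes "c \<le> d" and \<sigma>: "\<sigma> = 1 \<or> \<sigma> = -1" and K: "\<sigma> * (g d - g c) = \<bar>g d - g c\<bar>"
    and fin: "finite F" and F: "\<And>u v. (u, v) \<in> F \<Longrightarrow> u < v \<and> c \<le> u \<and> v \<le> d"
    and steep: "\<And>u v. (u, v) \<in> F \<Longrightarrow> \<sigma> * (g v - g u) \<le> - s * (v - u)"
    and disj: "pairwise (\<lambda>p q. disjnt {fst p..snd p} {fst q..snd q}) F"
  shows "\<exists>q. q division_of {c..d} \<and>
    \<bar>g d - g c\<bar> + 2 * s * (\<Sum>(u, v)\<in>F. v - u) \<le> (\<Sum>K\<in>q. \<bar>increment g K\<bar>)"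
proof -
  obtain q where q: "q division_of {c..d}" "(\<lambda>(u, v). {u..v}) ` F \<subseteq> q"
    "inj_on (\<lambda>(u, v). {u..v}) F"
    using extend_disjoint_intervals[OF fin F disj] by metis
  have "2 * s * (\<Sum>(u, v)\<in>F. v - u) = (\<Sum>(u, v)\<in>F. 2 * s * (v - u))"
    by (simp add: sum_distrib_left case_prod_beta)
  also have "\<dots> \<le> (\<Sum>(u, v)\<in>F. \<bar>increment g {u..v}\<bar> - \<sigma> * increment g {u..v})"
  proof (rule sum_mono, clarify)
    fix u v assume uv: "(u, v) \<in> F"
    then show "2 * s * (v - u) \<le> \<bar>increment g {u..v}\<bar> - \<sigma> * increment g {u..v}"
      using F[OF uv] steep[OF uv] \<sigma> by auto
  qed
  also have "\<dots> \<le> (\<Sum>K\<in>q. \<bar>increment g K\<bar> - \<sigma> * increment g K)"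
    using sum_disjoint_intervals_le[OF q, of "\<lambda>K. \<bar>increment g K\<bar> - \<sigma> * increment g K"] \<sigma> by auto
  also have "\<dots> = (\<Sum>K\<in>q. \<bar>increment g K\<bar>) - \<bar>g d - g c\<bar>"
    using sum_increment_division[OF q(1) \<open>c \<le> d\<close>, of g] K
    by (simp add: sum_subtractf sum_distrib_left[symmetric])
  finally show ?thesis using q(1) by auto
qed

text \<open>The core of the covering argument: a function of bounded variation cannot have both slopes above \<open>s\<close>
  and slopes below \<open>-s\<close> at arbitrarily small scales around the points of a set of positive measure.\<close>

lemma negligible_oscillating_slope:
  fixes c d s M :: real
  assumes bv: "bounded_var g c d M" and "c < d" "s > 0" and E: "E \<subseteq> {c<..<d}"
    and up: "\<And>x e. x \<in> E \<Longrightarrow> e > 0 \<Longrightarrow>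
      \<exists>u v. u < v \<and> x \<in> {u..v} \<and> v - u < e \<and> g v - g u \<ge> s * (v - u)"
    and dn: "\<And>x e. x \<in> E \<Longrightarrow> e > 0 \<Longrightarrow>
      \<exists>u v. u < v \<and> x \<in> {u..v} \<and> v - u < e \<and> g v - g u \<le> - s * (v - u)"
  shows "negligible E"
proof -
  define var where "var D = (\<Sum>K\<in>D. \<bar>increment g K\<bar>)" for D
  define V where "V = Sup (var ` {D. D division_of {c..d}})"
  have bdd: "bdd_above (var ` {D. D division_of {c..d}})"
    using bv by (auto simp: bdd_above_def bounded_var_def var_def)
  have varV: "var D \<le> V" if "D division_of {c..d}" for D
    unfolding V_def using that bdd by (intro cSup_upper) auto
  have ne: "var ` {D. D division_of {c..d}} \<noteq> {}"
    using division_of_self[of c d] \<open>c < d\<close> by auto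
  show ?thesis
    unfolding negligible_outer_le
  proof (intro allI impI)
    fix e :: real assume "e > 0"
    then have "V - 2 * s * e < V" using \<open>s > 0\<close> by simp
    then obtain D where D: "D division_of {c..d}" and Dv: "V - 2 * s * e < var D"
      unfolding V_def less_cSup_iff[OF ne bdd] by auto
    \<comment> \<open>Around a point outside \<open>N\<close> short intervals stay inside one cell of \<open>D\<close>.\<close>
    define N where "N = Inf ` D \<union> Sup ` D"
    \<comment> \<open>In each cell, collect the intervals moving against the increment over that cell.\<close>
    define \<sigma> where "\<sigma> K = (if increment g K \<ge> 0 then 1 else -1 :: real)" for K
    define J where "J = {(u, v). u < v \<and> (\<exists>K\<in>D. {u..v} \<subseteq> K \<and> \<sigma> K * (g v - g u) \<le> - s * (v - u))}"
    have finD: "finite D" using D by auto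
    obtain T where T: "E - N \<subseteq> T" "T \<in> lmeasurable" "measure lebesgue T \<le> e"
    proof (rule vitali_measure_bound[of J "E - N" e])
      show "u < v" if "(u, v) \<in> J" for u v using that by (simp add: J_def)
    next
      fix x \<delta> :: real assume x: "x \<in> E - N" and "\<delta> > 0"
      have "x \<in> \<Union>D" using x E division_ofD(6)[OF D] by auto
      then obtain K where K: "K \<in> D" "x \<in> K" by auto
      then obtain k l where kl: "K = {k..l}" "k \<le> l" using division_member_Icc[OF D] by metis
      then have "k \<in> N" "l \<in> N" using K imageI[of K D Inf] imageI[of K D Sup] by (auto simp: N_def)
      then have "x \<noteq> k" "x \<noteq> l" using x by auto
      then have klx: "k < x" "x < l" using K kl by auto
      define \<epsilon> where "\<epsilon> = min \<delta> (min (x - k) (l - x))"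
      have \<epsilon>: "\<epsilon> > 0" using klx \<open>\<delta> > 0\<close> by (simp add: \<epsilon>_def)
      obtain u v where uv: "u < v" "x \<in> {u..v}" "v - u < \<epsilon>"
          "\<sigma> K * (g v - g u) \<le> - s * (v - u)"
        using up[of x, OF _ \<epsilon>] dn[of x, OF _ \<epsilon>] x by (cases "increment g K \<ge> 0") (auto simp: \<sigma>_def)
      moreover have "{u..v} \<subseteq> K" using uv kl by (auto simp: \<epsilon>_def)
      moreover have "v - u < \<delta>" using uv(3) by (simp add: \<epsilon>_def)
      ultimately show "\<exists>u v. (u, v) \<in> J \<and> x \<in> {u..v} \<and> v - u < \<delta>"
        using K(1) unfolding J_def by blast
    next
      fix F assume F: "finite F" "F \<subseteq> J"
        "pairwise (\<lambda>p q. disjnt {fst p..snd p} {fst q..snd q}) F"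
      define FK where "FK K = {(u, v) \<in> F. {u..v} \<subseteq> K \<and> \<sigma> K * (g v - g u) \<le> - s * (v - u)}" for K
      have FKF: "FK K \<subseteq> F" for K by (auto simp: FK_def)
      have lt: "u < v" if "(u, v) \<in> F" for u v using that F(2) by (auto simp: J_def)
      have "\<forall>K\<in>D. \<exists>q. q division_of K \<and>
          \<bar>increment g K\<bar> + 2 * s * (\<Sum>(u, v)\<in>FK K. v - u) \<le> (\<Sum>L\<in>q. \<bar>increment g L\<bar>)"
      proof
        fix K assume "K \<in> D"
        then obtain k l where kl: "K = {k..l}" "k \<le> l" using division_member_Icc[OF D] by metis
        have "\<exists>q. q division_of {k..l} \<and>
          \<bar>g l - g k\<bar> + 2 * s * (\<Sum>(u, v)\<in>FK K. v - u) \<le> (\<Sum>L\<in>q. \<bar>increment g L\<bar>)"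
        proof (rule steep_opposite_increments_variation[where \<sigma>="\<sigma> K"])
          show "\<sigma> K * (g l - g k) = \<bar>g l - g k\<bar>" using kl by (auto simp: \<sigma>_def)
          show "finite (FK K)" using F(1) FKF finite_subset by blast
          show "u < v \<and> k \<le> u \<and> v \<le> l" if uv: "(u, v) \<in> FK K" for u v
            using lt[of u v] uv kl by (auto simp: FK_def)
          show "pairwise (\<lambda>p q. disjnt {fst p..snd p} {fst q..snd q}) (FK K)"
            using F(3) FKF by (rule pairwise_subset)
        qed (auto simp: \<sigma>_def FK_def kl)
        then show "\<exists>q. q division_of K \<and>
          \<bar>increment g K\<bar> + 2 * s * (\<Sum>(u, v)\<in>FK K. v - u) \<le> (\<Sum>L\<in>q. \<bar>increment g L\<bar>)"
          using kl by simp
      qed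
      then obtain q where q: "\<And>K. K \<in> D \<Longrightarrow> q K division_of K"
        and qv: "\<And>K. K \<in> D \<Longrightarrow>
          \<bar>increment g K\<bar> + 2 * s * (\<Sum>(u, v)\<in>FK K. v - u) \<le> (\<Sum>L\<in>q K. \<bar>increment g L\<bar>)"
        by metis
      have "(\<Sum>(u, v)\<in>F. v - u) \<le> (\<Sum>(u, v)\<in>F. \<Sum>K\<in>D. if (u, v) \<in> FK K then v - u else 0)"
      proof (rule sum_mono, clarify)
        fix u v assume uv: "(u, v) \<in> F"
        then obtain K where "K \<in> D" "(u, v) \<in> FK K" using F(2) by (auto simp: J_def FK_def)
        then show "v - u \<le> (\<Sum>K\<in>D. if (u, v) \<in> FK K then v - u else 0)"
          using member_le_sum[of K D "\<lambda>K. if (u, v) \<in> FK K then v - u else 0"] lt[OF uv] finD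
          by auto
      qed
      also have "\<dots> = (\<Sum>K\<in>D. \<Sum>p\<in>F. if p \<in> FK K then snd p - fst p else 0)"
        by (subst sum.swap) (simp add: case_prod_beta)
      also have "\<dots> = (\<Sum>K\<in>D. \<Sum>(u, v)\<in>FK K. v - u)"
      proof (rule sum.cong[OF refl])
        fix K
        have "F \<inter> FK K = FK K" using FKF by auto
        then show "(\<Sum>p\<in>F. if p \<in> FK K then snd p - fst p else 0) = (\<Sum>(u, v)\<in>FK K. v - u)"
          using sum.inter_restrict[OF F(1), of "\<lambda>p. snd p - fst p" "FK K"]
          by (simp add: case_prod_beta)
      qed
      finally have "2 * s * (\<Sum>(u, v)\<in>F. v - u) \<le> 2 * s * (\<Sum>K\<in>D. \<Sum>(u, v)\<in>FK K. v - u)"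
        using \<open>s > 0\<close> by simp
      also have "\<dots> \<le> (\<Sum>K\<in>D. (\<Sum>L\<in>q K. \<bar>increment g L\<bar>) - \<bar>increment g K\<bar>)"
        unfolding sum_distrib_left by (intro sum_mono) (use qv in \<open>force simp: sum_distrib_left\<close>)
      also have "\<dots> = var (\<Union>K\<in>D. q K) - var D"
        using refine_division(2)[OF D q, of g] by (simp add: var_def sum_subtractf)
      also have "\<dots> \<le> V - var D" using varV refine_division(1)[OF D q] by force
      also have "\<dots> \<le> 2 * s * e" using Dv by simp
      finally show "(\<Sum>(u, v)\<in>F. v - u) \<le> e" using \<open>s > 0\<close> by simp
    qed
    have N: "negligible N" unfolding N_def using finD by (intro negligible_finite) auto
    show "\<exists>T. E \<subseteq> T \<and> T \<in> lmeasurable \<and> measure lebesgue T \<le> e"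
    proof (intro exI conjI)
      show "E \<subseteq> T \<union> N" using T by auto
      show "T \<union> N \<in> lmeasurable"
        using T N negligible_imp_measurable by (intro fmeasurable.Un) auto
      have "measure lebesgue (T \<union> N) \<le> measure lebesgue T + measure lebesgue N"
        by (rule measure_Un_le) (use T N negligible_imp_measurable in blast)+
      with T N show "measure lebesgue (T \<union> N) \<le> e" by (simp add: negligible_imp_measure0)
    qed
  qed
qed

lemma negligible_infinite_slope:
  fixes c d M :: real
  assumes bv: "bounded_var g c d M" and "c < d" and E: "E \<subseteq> {c<..<d}"
    and steep: "\<And>x e n. x \<in> E \<Longrightarrow> e > 0 \<Longrightarrow> n > 0 \<Longrightarrow>
      \<exists>u v. u < v \<and> x \<in> {u..v} \<and> v - u < e \<and> \<bar>g v - g u\<bar> \<ge> n * (v - u)"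
  shows "negligible E"
  unfolding negligible_outer_le
proof (intro allI impI)
  fix e :: real assume "e > 0"
  have "M \<ge> \<bar>g d - g c\<bar>"
    using bv division_of_self[of c d] \<open>c < d\<close> by (auto simp: bounded_var_def)
  then have "M \<ge> 0" by linarith
  define n where "n = (M + 1) / e"
  have n: "n > 0" using \<open>M \<ge> 0\<close> \<open>e > 0\<close> by (simp add: n_def)
  define J where "J = {(u, v). u < v \<and> c \<le> u \<and> v \<le> d \<and> \<bar>g v - g u\<bar> \<ge> n * (v - u)}"
  obtain T where T: "E \<subseteq> T" "T \<in> lmeasurable" "measure lebesgue T \<le> e"
  proof (rule vitali_measure_bound[of J E e])
    show "u < v" if "(u, v) \<in> J" for u v using that by (simp add: J_def)
  next
    fix x \<delta> :: real assume x: "x \<in> E" and "\<delta> > 0"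
    define \<epsilon> where "\<epsilon> = min \<delta> (min (x - c) (d - x))"
    have "\<epsilon> > 0" using x E \<open>\<delta> > 0\<close> by (auto simp: \<epsilon>_def)
    from steep[OF x this n] obtain u v where uv: "u < v" "x \<in> {u..v}" "v - u < \<epsilon>"
      "\<bar>g v - g u\<bar> \<ge> n * (v - u)" by blast
    then show "\<exists>u v. (u, v) \<in> J \<and> x \<in> {u..v} \<and> v - u < \<delta>"
      by (intro exI[of _ u] exI[of _ v]) (auto simp: \<epsilon>_def J_def)
  next
    fix F assume F: "finite F" "F \<subseteq> J"
      "pairwise (\<lambda>p q. disjnt {fst p..snd p} {fst q..snd q}) F"
    have Fp: "u < v \<and> c \<le> u \<and> v \<le> d" if "(u, v) \<in> F" for u v
      using that F(2) by (auto simp: J_def)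
    obtain q where q: "q division_of {c..d}" "(\<lambda>(u, v). {u..v}) ` F \<subseteq> q"
      "inj_on (\<lambda>(u, v). {u..v}) F"
      using extend_disjoint_intervals[OF F(1) Fp F(3)] by metis
    have "n * (\<Sum>(u, v)\<in>F. v - u) = (\<Sum>(u, v)\<in>F. n * (v - u))"
      by (simp add: sum_distrib_left case_prod_beta)
    also have "\<dots> \<le> (\<Sum>(u, v)\<in>F. \<bar>increment g {u..v}\<bar>)"
      using F(2) by (intro sum_mono) (auto simp: J_def)
    also have "\<dots> \<le> (\<Sum>K\<in>q. \<bar>increment g K\<bar>)"
      by (rule sum_disjoint_intervals_le[OF q]) auto
    also have "\<dots> \<le> M" using bv q(1) by (auto simp: bounded_var_def)
    also have "\<dots> \<le> n * e" using \<open>e > 0\<close> by (simp add: n_def)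
    finally show "(\<Sum>(u, v)\<in>F. v - u) \<le> e" using n by simp
  qed
  then show "\<exists>T. E \<subseteq> T \<and> T \<in> lmeasurable \<and> measure lebesgue T \<le> e" by blast
qed

section \<open>Absolutely continuous functions are differentiable almost everywhere\<close>

lemma bounded_var_minus_linear:
  assumes "bounded_var g c d M" "c \<le> d"
  shows "bounded_var (\<lambda>x. g x - m * x) c d (M + \<bar>m\<bar> * (d - c))"
  unfolding bounded_var_def
proof (intro allI impI)
  fix D assume D: "D division_of {c..d}"
  have "(\<Sum>K\<in>D. \<bar>increment (\<lambda>x. g x - m * x) K\<bar>) \<le> (\<Sum>K\<in>D. \<bar>increment g K\<bar> + \<bar>m\<bar> * increment (\<lambda>x. x) K)"
  proof (rule sum_mono)
    fix K assume "K \<in> D"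
    then obtain k l where kl: "K = {k..l}" "k \<le> l" using division_member_Icc[OF D] by metis
    have "\<bar>(g l - g k) - m * (l - k)\<bar> \<le> \<bar>g l - g k\<bar> + \<bar>m * (l - k)\<bar>"
      by (rule abs_triangle_ineq4)
    also have "\<bar>m * (l - k)\<bar> = \<bar>m\<bar> * (l - k)" using kl by (simp add: abs_mult)
    finally show "\<bar>increment (\<lambda>x. g x - m * x) K\<bar> \<le> \<bar>increment g K\<bar> + \<bar>m\<bar> * increment (\<lambda>x. x) K"
      using kl by (simp add: algebra_simps)
  qed
  also have "\<dots> \<le> M + \<bar>m\<bar> * (d - c)"
    using assms(1) D sum_increment_division[OF D assms(2), of "\<lambda>x. x"]
    by (simp add: sum.distrib sum_distrib_left[symmetric] bounded_var_def)
  finally show "(\<Sum>K\<in>D. \<bar>increment (\<lambda>x. g x - m * x) K\<bar>) \<le> M + \<bar>m\<bar> * (d - c)" .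
qed

text \<open>The two ways to fail differentiability: the difference quotients oscillate across a rational gap,
  or they are unbounded arbitrarily close to the point. The second alternative is stated so as to
  cover the limits \<open>\<infinity>\<close> and \<open>-\<infinity>\<close>.\<close>

lemma not_differentiable_slopes:
  fixes g :: "real \<Rightarrow> real"
  defines "Q \<equiv> \<lambda>x y. (g y - g x) / (y - x)"
  assumes nd: "\<not> g differentiable (at x)"
  shows "(\<exists>\<alpha>\<in>\<rat>. \<exists>\<beta>\<in>\<rat>. \<alpha> < \<beta> \<and> (\<exists>\<^sub>F y in at x. Q x y < \<alpha>) \<and> (\<exists>\<^sub>F y in at x. Q x y > \<beta>)) \<or>
    (\<forall>n. \<exists>\<^sub>F y in at x. \<bar>Q x y\<bar> \<ge> n)"
proof -
  define L where "L = Liminf (at x) (\<lambda>y. ereal (Q x y))"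
  define U where "U = Limsup (at x) (\<lambda>y. ereal (Q x y))"
  have freq_lt: "\<exists>\<^sub>F y in at x. Q x y < z" if "L < ereal z" for z
  proof (rule ccontr)
    assume "\<not> ?thesis"
    then have "\<forall>\<^sub>F y in at x. ereal z \<le> ereal (Q x y)" by (simp add: not_frequently not_less)
    then have "ereal z \<le> L" unfolding L_def by (rule Liminf_bounded)
    with that show False by simp
  qed
  have freq_gt: "\<exists>\<^sub>F y in at x. Q x y > z" if "U > ereal z" for z
  proof (rule ccontr)
    assume "\<not> ?thesis"
    then have "\<forall>\<^sub>F y in at x. ereal (Q x y) \<le> ereal z" by (simp add: not_frequently not_less)
    then have "U \<le> ereal z" unfolding U_def by (rule Limsup_bounded)
    with that show False by simp
  qed
  have "L \<le> U" unfolding L_def U_def by (rule Liminf_le_Limsup) simp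
  then consider "L < U" | "L = U" by fastforce
  then show ?thesis
  proof cases
    case 1
    obtain z2 where z2: "L < ereal z2" "ereal z2 < U" using ereal_dense2[OF 1] by blast
    obtain z1 where z1: "L < ereal z1" "ereal z1 < ereal z2" using ereal_dense2[OF z2(1)] by blast
    then have "z1 < z2" by simp
    obtain \<alpha> where \<alpha>: "\<alpha> \<in> \<rat>" "z1 < \<alpha>" "\<alpha> < z2" using Rats_dense_in_real[OF \<open>z1 < z2\<close>] by blast
    obtain \<beta> where \<beta>: "\<beta> \<in> \<rat>" "\<alpha> < \<beta>" "\<beta> < z2" using Rats_dense_in_real[OF \<alpha>(3)] by blast
    have "L < ereal \<alpha>" using z1(1) \<alpha>(2) by (meson less_ereal.simps(1) less_trans)
    moreover have "ereal \<beta> < U" using z2(2) \<beta>(3) by (meson less_ereal.simps(1) less_trans)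
    ultimately show ?thesis using freq_lt freq_gt \<alpha> \<beta> by blast
  next
    case 2
    show ?thesis
    proof (cases L)
      case (real r)
      have "((\<lambda>y. ereal (Q x y)) \<longlongrightarrow> ereal r) (at x)"
        using 2 real by (intro Liminf_eq_Limsup) (auto simp: L_def U_def)
      then have "(Q x \<longlongrightarrow> r) (at x)" by simp
      then have "(g has_field_derivative r) (at x)"
        unfolding has_field_derivative_iff Q_def .
      with nd show ?thesis using real_differentiable_def by blast
    next
      case PInf
      have "\<exists>\<^sub>F y in at x. n \<le> \<bar>Q x y\<bar>" for n
        by (rule frequently_elim1[OF freq_gt[of n]]) (use PInf 2 in auto)
      then show ?thesis by blast
    next
      case MInf
      have "\<exists>\<^sub>F y in at x. n \<le> \<bar>Q x y\<bar>" for n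
        by (rule frequently_elim1[OF freq_lt[of "-n"]]) (use MInf in auto)
      then show ?thesis by blast
    qed
  qed
qed

lemma frequently_at_interval:
  fixes x e :: real
  assumes "\<exists>\<^sub>F y in at x. P ((g y - g x) / (y - x))" "e > 0"
  shows "\<exists>u v. u < v \<and> x \<in> {u..v} \<and> v - u < e \<and> P ((g v - g u) / (v - u))"
proof -
  obtain y where y: "y \<noteq> x" "\<bar>y - x\<bar> < e" "P ((g y - g x) / (y - x))"
    using assms unfolding frequently_at by (auto simp: dist_real_def)
  have "(g y - g x) / (y - x) = (g x - g y) / (x - y)"
    by (metis minus_diff_eq minus_divide_divide)
  with y show ?thesis
    by (cases "y < x") (force intro: exI[of _ y] exI[of _ x])+
qed

lemma bounded_var_differentiable_ae:
  assumes bv: "bounded_var g c d M" and "c < d"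
  shows "negligible {x\<in>{c<..<d}. \<not> g differentiable (at x)}"
proof -
  define Q where "Q = (\<lambda>x y. (g y - g x) / (y - x))"
  define E where "E \<alpha> \<beta> = {x\<in>{c<..<d}. (\<exists>\<^sub>F y in at x. Q x y < \<alpha>) \<and> (\<exists>\<^sub>F y in at x. Q x y > \<beta>)}"
    for \<alpha> \<beta>
  define Einf where "Einf = {x\<in>{c<..<d}. \<forall>n. \<exists>\<^sub>F y in at x. \<bar>Q x y\<bar> \<ge> n}"
  have "negligible (E \<alpha> \<beta>)" if "\<alpha> < \<beta>" for \<alpha> \<beta>
  proof (rule negligible_oscillating_slope)
    \<comment> \<open>Subtracting the linear function of mean slope makes the oscillation symmetric around 0.\<close>
    let ?m = "(\<alpha> + \<beta>) / 2"
    show "bounded_var (\<lambda>x. g x - ?m * x) c d (M + \<bar>?m\<bar> * (d - c))"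
      using bv \<open>c < d\<close> by (intro bounded_var_minus_linear) auto
    show "(\<beta> - \<alpha>) / 2 > 0" using that by simp
    show "E \<alpha> \<beta> \<subseteq> {c<..<d}" by (auto simp: E_def)
    fix x e :: real assume x: "x \<in> E \<alpha> \<beta>" and e: "e > 0"
    show "\<exists>u v. u < v \<and> x \<in> {u..v} \<and> v - u < e \<and>
        (\<beta> - \<alpha>) / 2 * (v - u) \<le> g v - ?m * v - (g u - ?m * u)"
    proof -
      obtain u v where "u < v" "x \<in> {u..v}" "v - u < e" "\<beta> < (g v - g u) / (v - u)"
        using frequently_at_interval[of "\<lambda>t. \<beta> < t", OF _ e] x unfolding E_def Q_def by blast
      then show ?thesis by (intro exI[of _ u] exI[of _ v]) (simp add: field_simps)
    qed
    show "\<exists>u v. u < v \<and> x \<in> {u..v} \<and> v - u < e \<and>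
        g v - ?m * v - (g u - ?m * u) \<le> - ((\<beta> - \<alpha>) / 2) * (v - u)"
    proof -
      obtain u v where "u < v" "x \<in> {u..v}" "v - u < e" "(g v - g u) / (v - u) < \<alpha>"
        using frequently_at_interval[of "\<lambda>t. t < \<alpha>", OF _ e] x unfolding E_def Q_def by blast
      then show ?thesis by (intro exI[of _ u] exI[of _ v]) (simp add: field_simps)
    qed
  qed (use \<open>c < d\<close> in auto)
  moreover have "negligible Einf"
  proof (rule negligible_infinite_slope[OF bv \<open>c < d\<close>])
    show "Einf \<subseteq> {c<..<d}" by (auto simp: Einf_def)
    fix x e n :: real assume x: "x \<in> Einf" and e: "e > 0" and "n > 0"
    obtain u v where "u < v" "x \<in> {u..v}" "v - u < e" "n \<le> \<bar>(g v - g u) / (v - u)\<bar>"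
      using frequently_at_interval[of "\<lambda>t. n \<le> \<bar>t\<bar>", OF _ e] x unfolding Einf_def Q_def by blast
    then show "\<exists>u v. u < v \<and> x \<in> {u..v} \<and> v - u < e \<and> n * (v - u) \<le> \<bar>g v - g u\<bar>"
      by (intro exI[of _ u] exI[of _ v]) (simp add: field_simps abs_divide)
  qed
  moreover have "countable {p\<in>\<rat> \<times> \<rat>. fst p < (snd p :: real)}"
    by (rule countable_subset[of _ "\<rat> \<times> \<rat>"]) (auto simp: countable_rat)
  ultimately have "negligible (Einf \<union> (\<Union>p\<in>{p\<in>\<rat> \<times> \<rat>. fst p < snd p}. E (fst p) (snd p)))"
    by (intro negligible_Un negligible_countable_Union countable_image) auto
  then show ?thesis
  proof (rule negligible_subset)
    show "{x\<in>{c<..<d}. \<not> g differentiable (at x)} \<subseteq>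
      Einf \<union> (\<Union>p\<in>{p\<in>\<rat> \<times> \<rat>. fst p < snd p}. E (fst p) (snd p))"
      using not_differentiable_slopes[of g] unfolding Einf_def E_def Q_def by fastforce
  qed
qed

text \<open>Absolute continuity for families indexed by an arbitrary finite set.\<close>

lemma abs_continuous_on_finite_families:
  assumes "abs_continuous_on I g" "\<epsilon> > 0"
  shows "\<exists>\<delta>>0. \<forall>(A :: 'i set) u v. finite A \<longrightarrow> (\<forall>i\<in>A. u i \<le> v i \<and> {u i..v i} \<subseteq> I) \<longrightarrow>
       disjoint_family_on (\<lambda>i. {u i<..<v i}) A \<longrightarrow> (\<Sum>i\<in>A. v i - u i) < \<delta> \<longrightarrow>
       (\<Sum>i\<in>A. \<bar>g (v i) - g (u i)\<bar>) < \<epsilon>"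
proof -
  obtain \<delta> where "\<delta> > 0" and \<delta>: "\<And>(n::nat) u v. (\<forall>i<n. u i \<le> v i \<and> {u i..v i} \<subseteq> I) \<Longrightarrow>
        disjoint_family_on (\<lambda>i. {u i<..<v i}) {..<n} \<Longrightarrow> (\<Sum>i<n. v i - u i) < \<delta> \<Longrightarrow>
        (\<Sum>i<n. \<bar>g (v i) - g (u i)\<bar>) < \<epsilon>"
    using assms unfolding abs_continuous_on_def by meson
  show ?thesis
  proof (rule exI[of _ \<delta>], intro conjI allI impI)
    show "\<delta> > 0" by fact
    fix A :: "'i set" and u v
    assume A: "finite A" "\<forall>i\<in>A. u i \<le> v i \<and> {u i..v i} \<subseteq> I"
      "disjoint_family_on (\<lambda>i. {u i<..<v i}) A" "(\<Sum>i\<in>A. v i - u i) < \<delta>"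
    obtain b where b: "bij_betw b {..<card A} A"
      using ex_bij_betw_nat_finite[OF A(1)] by (auto simp: lessThan_atLeast0)
    have "(\<Sum>i<card A. \<bar>g (v (b i)) - g (u (b i))\<bar>) < \<epsilon>"
    proof (rule \<delta>)
      show "\<forall>i<card A. u (b i) \<le> v (b i) \<and> {u (b i)..v (b i)} \<subseteq> I"
        using b A(2) by (auto simp: bij_betw_def)
      show "disjoint_family_on (\<lambda>i. {u (b i)<..<v (b i)}) {..<card A}"
        unfolding disjoint_family_on_def
      proof (intro ballI impI)
        fix i j assume "i \<in> {..<card A}" "j \<in> {..<card A}" "i \<noteq> j"
        then have "b i \<in> A" "b j \<in> A" "b i \<noteq> b j" using b by (auto simp: bij_betw_def inj_on_def)
        then show "{u (b i)<..<v (b i)} \<inter> {u (b j)<..<v (b j)} = {}"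
          using A(3) by (simp add: disjoint_family_on_def)
      qed
      show "(\<Sum>i<card A. v (b i) - u (b i)) < \<delta>"
        using A(4) sum.reindex_bij_betw[OF b, of "\<lambda>i. v i - u i"] by simp
    qed
    then show "(\<Sum>i\<in>A. \<bar>g (v i) - g (u i)\<bar>) < \<epsilon>"
      using sum.reindex_bij_betw[OF b, of "\<lambda>i. \<bar>g (v i) - g (u i)\<bar>"] by simp
  qed
qed

text \<open>On an interval shorter than the \<open>\<delta>\<close> belonging to \<open>\<epsilon> = 1\<close>, every division is an admissible family,
  so the variation is at most 1. As differentiability is local, short intervals suffice.\<close>

lemma abs_continuous_on_bounded_var:
  assumes "abs_continuous_on I g"
  shows "\<exists>\<delta>>0. \<forall>p q. p < q \<longrightarrow> {p..q} \<subseteq> I \<longrightarrow> q - p < \<delta> \<longrightarrow> bounded_var g p q 1"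
proof -
  obtain \<delta> where "\<delta> > 0" and \<delta>: "\<forall>(A :: real set set) u v. finite A \<longrightarrow>
       (\<forall>i\<in>A. u i \<le> v i \<and> {u i..v i} \<subseteq> I) \<longrightarrow>
       disjoint_family_on (\<lambda>i. {u i<..<v i}) A \<longrightarrow> (\<Sum>i\<in>A. v i - u i) < \<delta> \<longrightarrow>
       (\<Sum>i\<in>A. \<bar>g (v i) - g (u i)\<bar>) < 1"
    using abs_continuous_on_finite_families[OF assms zero_less_one] by (elim exE conjE) (rule that)
  show ?thesis
  proof (rule exI[of _ \<delta>], intro conjI allI impI)
    show "\<delta> > 0" by fact
    fix p q :: real assume pq: "p < q" "{p..q} \<subseteq> I" "q - p < \<delta>"
    show "bounded_var g p q 1"
      unfolding bounded_var_def
    proof (intro allI impI)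
      fix D assume D: "D division_of {p..q}"
      have KD: "K = {Inf K..Sup K} \<and> Inf K \<le> Sup K \<and> interior K = {Inf K<..<Sup K}" if "K \<in> D" for K
      proof -
        obtain k l where "K = {k..l}" "k \<le> l" using division_member_Icc[OF D \<open>K \<in> D\<close>] by metis
        then show ?thesis by simp
      qed
      have "(\<Sum>K\<in>D. \<bar>g (Sup K) - g (Inf K)\<bar>) < 1"
      proof (rule \<delta>[rule_format])
        show "Inf K \<le> Sup K \<and> {Inf K..Sup K} \<subseteq> I" if "K \<in> D" for K
          using KD[OF that] division_ofD(2)[OF D that] pq(2) by auto
        show "disjoint_family_on (\<lambda>K. {Inf K<..<Sup K}) D"
          unfolding disjoint_family_on_def
        proof (intro ballI impI)
          fix K L assume "K \<in> D" "L \<in> D" "K \<noteq> L"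
          then show "{Inf K<..<Sup K} \<inter> {Inf L<..<Sup L} = {}"
            using division_ofD(5)[OF D, of K L] KD[of K] KD[of L] by simp
        qed
        show "(\<Sum>K\<in>D. Sup K - Inf K) < \<delta>"
          using sum_increment_division[OF D, of "\<lambda>x. x"] pq by (simp add: increment_def)
      qed (use D in auto)
      then show "(\<Sum>K\<in>D. \<bar>increment g K\<bar>) \<le> 1" by (simp add: increment_def)
    qed
  qed
qed

theorem loc_abs_continuous_on_differentiable_ae:
  assumes "loc_abs_continuous_on I g" "open I"
  shows "negligible {x\<in>I. \<not> g differentiable (at x)}"
proof -
  define P where "P = {p\<in>\<rat> \<times> \<rat>. fst p < snd p \<and> bounded_var g (fst p) (snd p) 1}"
  have "negligible (\<Union>p\<in>P. {x\<in>{fst p<..<snd p}. \<not> g differentiable (at x)})"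
  proof (rule negligible_countable_Union)
    have "P \<subseteq> \<rat> \<times> \<rat>" by (auto simp: P_def)
    then have "countable P"
      by (rule countable_subset) (intro countable_SIGMA countable_rat)
    then show "countable ((\<lambda>p. {x\<in>{fst p<..<snd p}. \<not> g differentiable (at x)}) ` P)" by simp
    show "negligible S" if "S \<in> (\<lambda>p. {x\<in>{fst p<..<snd p}. \<not> g differentiable (at x)}) ` P" for S
    proof -
      from that obtain p where "p \<in> P" "S = {x\<in>{fst p<..<snd p}. \<not> g differentiable (at x)}"
        by auto
      then show ?thesis
        using bounded_var_differentiable_ae[of g "fst p" "snd p" 1] by (simp add: P_def)
    qed
  qed
  moreover have "\<exists>p\<in>P. x \<in> {fst p<..<snd p}" if x: "x \<in> I" for x
  proof -
    obtain r where r: "r > 0" "cball x r \<subseteq> I" using \<open>open I\<close> x open_contains_cball[of I] by auto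
    then have I: "{x - r..x + r} \<subseteq> I" by (simp add: cball_eq_atLeastAtMost)
    then have "abs_continuous_on {x - r..x + r} g"
      using assms(1) unfolding loc_abs_continuous_on_def by blast
    then obtain \<delta> where \<delta>: "\<delta> > 0"
      "\<forall>p q. p < q \<longrightarrow> {p..q} \<subseteq> {x - r..x + r} \<longrightarrow> q - p < \<delta> \<longrightarrow> bounded_var g p q 1"
      using abs_continuous_on_bounded_var by blast
    define \<epsilon> where "\<epsilon> = min r (\<delta> / 2)"
    have \<epsilon>: "\<epsilon> > 0" using r \<delta> by (simp add: \<epsilon>_def)
    obtain p where p: "p \<in> \<rat>" "x - \<epsilon> < p" "p < x" using Rats_dense_in_real[of "x - \<epsilon>" x] \<epsilon> by auto
    obtain q where q: "q \<in> \<rat>" "x < q" "q < x + \<epsilon>" using Rats_dense_in_real[of x "x + \<epsilon>"] \<epsilon> by auto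
    have "bounded_var g p q 1" using p q by (intro \<delta>(2)[rule_format]) (auto simp: \<epsilon>_def min_def split: if_splits)
    then show ?thesis using p q unfolding P_def by (intro bexI[of _ "(p, q)"]) auto
  qed
  then have "{x\<in>I. \<not> g differentiable (at x)} \<subseteq>
      (\<Union>p\<in>P. {x\<in>{fst p<..<snd p}. \<not> g differentiable (at x)})" by blast
  ultimately show ?thesis using negligible_subset by blast
qed

section \<open>The fundamental theorem of calculus for absolutely continuous functions\<close>

text \<open>The gauge forces tags in \<open>N\<close> to have their cells inside an open set of small measure, where
  absolute continuity controls the increments; at the other tags the derivative does.\<close>

theorem abs_continuous_has_integral_derivative:
  fixes g g' :: "real \<Rightarrow> real"
  assumes "a \<le> b" and ac: "abs_continuous_on {a..b} g" and N: "negligible N"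
    and deriv: "\<And>x. x \<in> {a..b} - N \<Longrightarrow> (g has_real_derivative g' x) (at x within {a..b})"
  shows "(g' has_integral (g b - g a)) {a..b}"
proof -
  define G where "G x = (if x \<in> N then 0 else g' x)" for x
  have "(G has_integral (g b - g a)) {a..b}"
    unfolding has_integral_real
  proof (intro allI impI)
    fix e :: real assume "e > 0"
    define e1 where "e1 = e / (2 * (b - a + 1))"
    have e1: "e1 > 0" "e1 * (b - a) < e / 2"
      using \<open>e > 0\<close> \<open>a \<le> b\<close> by (auto simp: e1_def field_simps)
    have "\<forall>x. \<exists>d>0. x \<in> {a..b} - N \<longrightarrow>
         (\<forall>y\<in>{a..b}. norm (y - x) < d \<longrightarrow> norm (g y - g x - g' x * (y - x)) \<le> e1 * norm (y - x))"
      using deriv e1(1) unfolding has_field_derivative_def has_derivative_within_alt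
      by (metis zero_less_one)
    then obtain d where d0: "\<And>x. d x > 0" and d: "\<And>x y. x \<in> {a..b} \<Longrightarrow> x \<notin> N \<Longrightarrow> y \<in> {a..b} \<Longrightarrow>
         \<bar>y - x\<bar> < d x \<Longrightarrow> \<bar>g y - g x - g' x * (y - x)\<bar> \<le> e1 * \<bar>y - x\<bar>"
      by (metis Diff_iff real_norm_def)
    obtain \<delta> where "\<delta> > 0" and \<delta>: "\<forall>(A :: (real \<times> real set) set) u v. finite A \<longrightarrow>
       (\<forall>i\<in>A. u i \<le> v i \<and> {u i..v i} \<subseteq> {a..b}) \<longrightarrow>
       disjoint_family_on (\<lambda>i. {u i<..<v i}) A \<longrightarrow> (\<Sum>i\<in>A. v i - u i) < \<delta> \<longrightarrow>
       (\<Sum>i\<in>A. \<bar>g (v i) - g (u i)\<bar>) < e / 2"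
      using abs_continuous_on_finite_families[OF ac half_gt_zero[OF \<open>e > 0\<close>]]
      by (elim exE conjE) (rule that)
    obtain U where U: "open U" "N \<subseteq> U" "U \<in> lmeasurable" "measure lebesgue U < \<delta>"
    proof -
      obtain U where U: "open U" "N \<subseteq> U" "U - N \<in> lmeasurable" "emeasure lebesgue (U - N) < ennreal \<delta>"
        using sets_lebesgue_outer_open[OF negligible_imp_sets[OF N] \<open>\<delta> > 0\<close>] by blast
      have UN: "U = (U - N) \<union> N" using U(2) by auto
      have "U \<in> lmeasurable"
        using U(3) N negligible_imp_measurable by (subst UN) (intro fmeasurable.Un)
      moreover have "measure lebesgue U \<le> measure lebesgue (U - N) + measure lebesgue N"
        by (subst UN, rule measure_Un_le) (use U(3) N negligible_imp_sets in blast)+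
      moreover have "measure lebesgue N = 0" using N by (rule negligible_imp_measure0)
      moreover have "measure lebesgue (U - N) < \<delta>"
        using U(4) \<open>\<delta> > 0\<close> by (simp add: emeasure_eq_measure2[OF U(3)] ennreal_less_iff)
      ultimately show thesis using U that[of U] by linarith
    qed
    define \<gamma> where "\<gamma> x = (if x \<in> N then U else ball x (d x))" for x
    show "\<exists>\<gamma>. gauge \<gamma> \<and> (\<forall>\<D>. \<D> tagged_division_of {a..b} \<and> \<gamma> fine \<D> \<longrightarrow>
        norm ((\<Sum>(x, k)\<in>\<D>. measure lborel k *\<^sub>R G x) - (g b - g a)) < e)"
    proof (intro exI[of _ \<gamma>] conjI allI impI)
      show "gauge \<gamma>" using U(1,2) d0 by (auto simp: gauge_def \<gamma>_def)
    next
      fix p assume "p tagged_division_of {a..b} \<and> \<gamma> fine p"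
      then have p: "p tagged_division_of {a..b}" and fine: "\<gamma> fine p" by auto
      have fin: "finite p" using p by auto
      define lo hi where "lo i = Inf (snd i)" and "hi i = Sup (snd i)" for i :: "real \<times> real set"
      have pK: "snd i = {lo i..hi i} \<and> lo i \<le> fst i \<and> fst i \<le> hi i \<and> a \<le> lo i \<and> hi i \<le> b
          \<and> snd i \<subseteq> \<gamma> (fst i)" if i: "i \<in> p" for i
      proof -
        obtain x K where xK: "i = (x, K)" by (cases i)
        have K: "x \<in> K" "K \<subseteq> {a..b}" using tagged_division_ofD(2,3)[OF p] i xK by auto
        obtain k l where "K = cbox k l" using tagged_division_ofD(4)[OF p] i xK by blast
        with K show ?thesis using fineD[OF fine, of x K] i
          by (auto simp: lo_def hi_def xK)
      qed
      define pN where "pN = {i \<in> p. fst i \<in> N}"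
      have pN: "finite pN" "pN \<subseteq> p" using fin by (auto simp: pN_def)
      have disj: "disjoint_family_on (\<lambda>i. {lo i<..<hi i}) pN"
        unfolding disjoint_family_on_def
      proof (intro ballI impI)
        fix i j assume ij: "i \<in> pN" "j \<in> pN" "i \<noteq> j"
        have "interior (snd i) \<inter> interior (snd j) = {}"
          using tagged_division_ofD(5)[OF p, of "fst i" "snd i" "fst j" "snd j"] ij pN(2) by auto
        then show "{lo i<..<hi i} \<inter> {lo j<..<hi j} = {}"
          using pK ij pN(2) by (metis interior_atLeastAtMost_real subsetD)
      qed
      have "(\<Sum>i\<in>pN. hi i - lo i) = (\<Sum>i\<in>pN. measure lebesgue {lo i<..<hi i})"
        using pK pN(2) by (intro sum.cong) fastforce+
      also have "\<dots> = measure lebesgue (\<Union>i\<in>pN. {lo i<..<hi i})"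
        using disj pN(1)
        by (subst measure_UNION') (auto simp: disjoint_family_on_def pairwise_def disjnt_def)
      also have "\<dots> \<le> measure lebesgue U"
      proof (rule measure_mono_fmeasurable)
        show "(\<Union>i\<in>pN. {lo i<..<hi i}) \<subseteq> U"
        proof (rule UN_least)
          fix i assume i: "i \<in> pN"
          then have "snd i \<subseteq> U" "snd i = {lo i..hi i}" using pK[of i] by (auto simp: pN_def \<gamma>_def)
          then show "{lo i<..<hi i} \<subseteq> U" by auto
        qed
      qed (use U pN in auto)
      finally have len: "(\<Sum>i\<in>pN. hi i - lo i) < \<delta>" using U(4) by simp
      have small: "(\<Sum>i\<in>pN. \<bar>g (hi i) - g (lo i)\<bar>) < e / 2"
      proof (rule \<delta>[rule_format])
        show "lo i \<le> hi i \<and> {lo i..hi i} \<subseteq> {a..b}" if "i \<in> pN" for i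
          using pK[of i] that pN(2) by auto
      qed (use pN disj len in auto)
      have cont: "measure lborel (snd i) = hi i - lo i" if "i \<in> p" for i
        using pK[OF that] by (metis measure_lborel_Icc order_trans)
      have "(\<Sum>(x, k)\<in>p. measure lborel k *\<^sub>R G x) - (g b - g a)
          = (\<Sum>i\<in>p. (hi i - lo i) * G (fst i) - (g (hi i) - g (lo i)))"
        using additive_tagged_division_1[OF \<open>a \<le> b\<close> p, of g] cont
        by (simp add: sum_subtractf case_prod_beta lo_def hi_def)
      also have "\<bar>\<dots>\<bar> \<le> (\<Sum>i\<in>p. \<bar>(hi i - lo i) * G (fst i) - (g (hi i) - g (lo i))\<bar>)"
        by (rule sum_abs)
      also have "\<dots> \<le> (\<Sum>i\<in>p. e1 * (hi i - lo i) + (if i \<in> pN then \<bar>g (hi i) - g (lo i)\<bar> else 0))"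
      proof (rule sum_mono)
        fix i assume i: "i \<in> p"
        note P = pK[OF i]
        show "\<bar>(hi i - lo i) * G (fst i) - (g (hi i) - g (lo i))\<bar>
            \<le> e1 * (hi i - lo i) + (if i \<in> pN then \<bar>g (hi i) - g (lo i)\<bar> else 0)"
        proof (cases "fst i \<in> N")
          case True
          then show ?thesis using i P e1 by (simp add: G_def pN_def abs_minus_commute)
        next
          case False
          let ?x = "fst i"
          have "lo i \<in> ball ?x (d ?x)" "hi i \<in> ball ?x (d ?x)"
            using P False by (auto simp: \<gamma>_def subset_iff)
          then have "\<bar>g (lo i) - g ?x - g' ?x * (lo i - ?x)\<bar> \<le> e1 * \<bar>lo i - ?x\<bar>"
            "\<bar>g (hi i) - g ?x - g' ?x * (hi i - ?x)\<bar> \<le> e1 * \<bar>hi i - ?x\<bar>"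
            using P False by (intro d; auto simp: dist_real_def)+
          moreover have "\<bar>lo i - ?x\<bar> = ?x - lo i" "\<bar>hi i - ?x\<bar> = hi i - ?x" using P by auto
          ultimately have "\<bar>(hi i - lo i) * g' ?x - (g (hi i) - g (lo i))\<bar>
              \<le> e1 * (?x - lo i) + e1 * (hi i - ?x)" by (simp add: algebra_simps abs_le_iff)
          then show ?thesis using False by (simp add: G_def pN_def algebra_simps)
        qed
      qed
      also have "\<dots> = e1 * (b - a) + (\<Sum>i\<in>pN. \<bar>g (hi i) - g (lo i)\<bar>)"
      proof -
        have "(\<Sum>i\<in>p. hi i - lo i) = b - a"
          using additive_tagged_division_1[OF \<open>a \<le> b\<close> p, of "\<lambda>x. x"]
          by (simp add: case_prod_beta lo_def hi_def)
        moreover have "p \<inter> pN = pN" using pN by auto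
        ultimately show ?thesis
          using sum.inter_restrict[OF fin, of "\<lambda>i. \<bar>g (hi i) - g (lo i)\<bar>" pN]
          by (simp add: sum.distrib sum_distrib_left[symmetric])
      qed
      also have "\<dots> < e" using e1(2) small by simp
      finally show "norm ((\<Sum>(x, k)\<in>p. measure lborel k *\<^sub>R G x) - (g b - g a)) < e" by simp
    qed
  qed
  then show ?thesis
    by (rule has_integral_spike[OF N, rotated]) (auto simp: G_def)
qed

section \<open>The signed power and Young's inequality\<close>

text \<open>The function \<open>\<Phi>(y) = |y|\<^sup>p\<^sup>-\<^sup>2 y\<close>.\<close>

definition signed_power :: "real \<Rightarrow> real \<Rightarrow> real" where
  "signed_power p y = \<bar>y\<bar> powr (p - 2) * y"

text \<open>The derivative of \<open>\<Phi>\<close>. The case \<open>p = 2\<close> is separate because \<open>0 powr 0 = 0\<close>, whereas the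
  derivative of the identity at \<open>0\<close> is 1.\<close>

definition signed_power_deriv :: "real \<Rightarrow> real \<Rightarrow> real" where
  "signed_power_deriv p y = (if p = 2 then 1 else (p - 1) * \<bar>y\<bar> powr (p - 2))"

lemma signed_power_2 [simp]: "signed_power 2 y = y"
  by (cases "y = 0") (auto simp: signed_power_def)

lemma signed_power_mult_self: "p \<ge> 2 \<Longrightarrow> signed_power p y * y = \<bar>y\<bar> powr p"
proof (cases "y = 0")
  case False
  have "\<bar>y\<bar> powr p = \<bar>y\<bar> powr (p - 2) * y\<^sup>2"
    using powr_add[of "\<bar>y\<bar>" "p - 2" 2] False by simp
  then show ?thesis by (simp add: signed_power_def power2_eq_square)
qed (simp add: signed_power_def)

lemma has_real_derivative_signed_power:
  assumes "p \<ge> 2"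
  shows "(signed_power p has_real_derivative signed_power_deriv p y) (at y)"
proof (cases "p = 2")
  case True
  moreover have "signed_power 2 = (\<lambda>y. y)" by (rule ext) simp
  ultimately show ?thesis by (simp add: signed_power_deriv_def)
next
  case False
  with assms have p: "p > 2" by simp
  consider "y > 0" | "y < 0" | "y = 0" by linarith
  then show ?thesis
  proof cases
    case 1
    have "((\<lambda>y. y powr (p - 2) * y) has_real_derivative (p - 1) * y powr (p - 2)) (at y)"
    proof -
      have "y powr (p - 3) * y = y powr (p - 2)"
        using 1 powr_add[of y "p - 3" 1] by simp
      then show ?thesis
        using 1 by (auto intro!: derivative_eq_intros simp: algebra_simps)
    qed
    then have "(signed_power p has_real_derivative (p - 1) * y powr (p - 2)) (at y)"
      by (rule DERIV_cong_ev[OF refl _ refl, THEN iffD1, rotated])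
        (use eventually_gt_at_top[of 0] 1 in
          \<open>auto simp: signed_power_def eventually_nhds intro!: exI[of _ "{0<..}"]\<close>)
    then show ?thesis using 1 False by (simp add: signed_power_deriv_def)
  next
    case 2
    have "((\<lambda>y. (- y) powr (p - 2) * y) has_real_derivative (p - 1) * (- y) powr (p - 2)) (at y)"
    proof -
      have "(-y) powr (p - 3) * (-y) = (-y) powr (p - 2)"
        using 2 powr_add[of "-y" "p - 3" 1] by simp
      then have "y * (-y) powr (p - 3) = - ((-y) powr (p - 2))" by (simp add: mult.commute)
      then show ?thesis
        using 2 by (auto intro!: derivative_eq_intros simp: algebra_simps)
    qed
    then have "(signed_power p has_real_derivative (p - 1) * (- y) powr (p - 2)) (at y)"
      by (rule DERIV_cong_ev[OF refl _ refl, THEN iffD1, rotated])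
        (use 2 in \<open>auto simp: signed_power_def eventually_nhds intro!: exI[of _ "{..<0}"]\<close>)
    then show ?thesis using 2 False by (simp add: signed_power_deriv_def)
  next
    case 3
    have "((\<lambda>z. \<bar>z\<bar> powr (p - 2)) \<longlongrightarrow> \<bar>0\<bar> powr (p - 2)) (at (0::real))"
      using p by (intro tendsto_powr' tendsto_rabs tendsto_ident_at tendsto_const) auto
    moreover have "\<forall>\<^sub>F z in at 0. \<bar>z\<bar> powr (p - 2) = (signed_power p z - signed_power p 0) / (z - 0)"
      by (rule eventually_at_filter[THEN iffD2]) (auto simp: signed_power_def)
    ultimately have "((\<lambda>z. (signed_power p z - signed_power p 0) / (z - 0)) \<longlongrightarrow> 0) (at 0)"
      using tendsto_cong by force
    then show ?thesis using 3 False by (simp add: has_field_derivative_iff signed_power_deriv_def)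
  qed
qed

lemma signed_power_lipschitz:
  assumes "p \<ge> 2"
  shows "\<exists>C\<ge>0. \<forall>y z. \<bar>y\<bar> \<le> M \<longrightarrow> \<bar>z\<bar> \<le> M \<longrightarrow>
    \<bar>signed_power p y - signed_power p z\<bar> \<le> C * \<bar>y - z\<bar>"
proof -
  define C where "C = 1 + (p - 1) * \<bar>M\<bar> powr (p - 2)"
  have "\<bar>signed_power p y - signed_power p z\<bar> \<le> C * \<bar>y - z\<bar>" if "\<bar>y\<bar> \<le> M" "\<bar>z\<bar> \<le> M" for y z
  proof -
    have "norm (signed_power p y - signed_power p z) \<le> C * norm (y - z)"
    proof (rule field_differentiable_bound[of "{-M..M}"])
      show "(signed_power p has_real_derivative signed_power_deriv p x) (at x within {-M..M})" for x
        using has_real_derivative_signed_power[OF assms] has_field_derivative_at_within by blast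
      show "norm (signed_power_deriv p x) \<le> C" if "x \<in> {-M..M}" for x
      proof -
        have "\<bar>x\<bar> powr (p - 2) \<le> \<bar>M\<bar> powr (p - 2)"
          using that assms by (intro powr_mono2) auto
        then have "(p - 1) * \<bar>x\<bar> powr (p - 2) \<le> (p - 1) * \<bar>M\<bar> powr (p - 2)"
          using assms by (intro mult_left_mono) auto
        moreover have "norm (signed_power_deriv p x) \<le> 1 + (p - 1) * \<bar>x\<bar> powr (p - 2)"
          using assms by (simp add: signed_power_deriv_def abs_mult)
        ultimately show ?thesis by (simp add: C_def)
      qed
    qed (use that in auto)
    then show ?thesis by simp
  qed
  moreover have "C \<ge> 0" using assms by (simp add: C_def)
  ultimately show ?thesis by blast
qed

text \<open>Young's inequality in the form in which one copy of \<open>|y|\<^sup>p\<close> is left over from \<open>p / 2 |y|\<^sup>p\<close>.\<close>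

lemma signed_power_deriv_young:
  assumes "p \<ge> 2" "t \<ge> 0"
  shows "p / 2 * (signed_power_deriv p y * t)
    \<le> (p / 2 - 1) * \<bar>y\<bar> powr p + sqrt (p - 1) powr p * t powr (p / 2)"
proof (cases "p = 2")
  case True
  then show ?thesis using assms by (simp add: signed_power_deriv_def)
next
  case False
  with assms have p: "p > 2" by simp
  define q where "q = p / (p - 2)"
  have conj: "p / 2 > 1" "q > 1" "1 / (p / 2) + 1 / q = 1"
    using p by (auto simp: q_def field_simps)
  have "((p - 1) * t) * \<bar>y\<bar> powr (p - 2)
      \<le> ((p - 1) * t) powr (p / 2) / (p / 2) + (\<bar>y\<bar> powr (p - 2)) powr q / q"
    using conj p assms by (intro Youngs_inequality) auto
  also have "(\<bar>y\<bar> powr (p - 2)) powr q = \<bar>y\<bar> powr p"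
    using p by (simp add: powr_powr q_def)
  also have "((p - 1) * t) powr (p / 2) = sqrt (p - 1) powr p * t powr (p / 2)"
    using p assms by (simp add: powr_mult powr_half_sqrt[symmetric] powr_powr)
  finally have "p / 2 * (((p - 1) * t) * \<bar>y\<bar> powr (p - 2)) \<le> p / 2 *
     (sqrt (p - 1) powr p * t powr (p / 2) / (p / 2) + \<bar>y\<bar> powr p / q)"
    using p by (intro mult_left_mono) auto
  also have "\<dots> = sqrt (p - 1) powr p * t powr (p / 2) + (p / 2 / q) * \<bar>y\<bar> powr p"
    using p by (simp add: distrib_left)
  also have "p / 2 / q = p / 2 - 1" using p by (simp add: q_def field_simps)
  finally show ?thesis using False by (simp add: signed_power_deriv_def mult_ac)
qed

section \<open>Truncating the weight near zero\<close>

text \<open>A continuous nondecreasing cutoff, \<open>0\<close> up to \<open>\<delta>\<close> and \<open>1\<close> from \<open>2 \<delta>\<close> on.\<close>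

definition cutoff :: "real \<Rightarrow> real \<Rightarrow> real" where
  "cutoff \<delta> t = min 1 (max 0 ((t - \<delta>) / \<delta>))"

lemma cutoff_bounds: "0 \<le> cutoff \<delta> t" "cutoff \<delta> t \<le> 1"
  by (auto simp: cutoff_def)

lemma cutoff_mono: "\<delta> > 0 \<Longrightarrow> s \<le> t \<Longrightarrow> cutoff \<delta> s \<le> cutoff \<delta> t"
  unfolding cutoff_def by (intro min.mono max.mono divide_right_mono) auto

lemma cutoff_eq_0: "\<delta> > 0 \<Longrightarrow> t \<le> \<delta> \<Longrightarrow> cutoff \<delta> t = 0"
  by (auto simp: cutoff_def field_simps max_def)

lemma cutoff_eq_1: "\<delta> > 0 \<Longrightarrow> 2 * \<delta> \<le> t \<Longrightarrow> cutoff \<delta> t = 1"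
  by (auto simp: cutoff_def field_simps min_def max_def)

lemma cutoff_tendsto: "t > 0 \<Longrightarrow> (\<lambda>n. cutoff (1 / real (Suc n)) t) \<longlonglongrightarrow> 1"
proof (rule tendsto_eventually)
  assume "t > 0"
  then obtain N where N: "2 / t < real N" using reals_Archimedean2 by blast
  show "\<forall>\<^sub>F n in sequentially. cutoff (1 / real (Suc n)) t = 1"
    using eventually_ge_at_top[of N]
  proof eventually_elim
    case (elim n)
    then have "2 / t < real (Suc n)" using N by linarith
    then show ?case using \<open>t > 0\<close> by (intro cutoff_eq_1) (auto simp: field_simps)
  qed
qed

text \<open>The weights of the theorem: continuous and positive on the positive half-line, integrable at 0.\<close>

locale weight =
  fixes h :: "real \<Rightarrow> real"
  assumes cont: "continuous_on {0<..} h"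
    and pos: "\<And>x. x > 0 \<Longrightarrow> h x > 0"
    and int: "\<And>\<epsilon>. \<epsilon> > 0 \<Longrightarrow> set_integrable lborel {0<..<\<epsilon>} h"
begin

text \<open>The truncated weight, extended evenly to the line. The cutoff vanishes where \<open>max \<delta> |y|\<close> differs
  from \<open>|y|\<close>; the maximum only makes continuity at \<open>0\<close> evident.\<close>

definition trunc :: "real \<Rightarrow> real \<Rightarrow> real" where
  "trunc \<delta> y = cutoff \<delta> \<bar>y\<bar> * h (max \<delta> \<bar>y\<bar>)"

text \<open>The odd primitive of the truncated weight; the interval integral is signed, so it also covers
  negative \<open>y\<close>.\<close>

definition trunc_prim :: "real \<Rightarrow> real \<Rightarrow> real" where
  "trunc_prim \<delta> y = (LBINT t=0..ereal y. trunc \<delta> t)"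

lemma trunc_nonneg: "\<delta> > 0 \<Longrightarrow> 0 \<le> trunc \<delta> y"
  using cutoff_bounds pos[of "max \<delta> \<bar>y\<bar>"] by (auto simp: trunc_def less_imp_le)

lemma trunc_0 [simp]: "\<delta> > 0 \<Longrightarrow> trunc \<delta> 0 = 0"
  by (simp add: trunc_def cutoff_eq_0)

lemma trunc_eq: "\<delta> > 0 \<Longrightarrow> trunc \<delta> y = cutoff \<delta> \<bar>y\<bar> * h \<bar>y\<bar>"
  by (cases "\<bar>y\<bar> \<le> \<delta>") (auto simp: trunc_def cutoff_eq_0 max_def)

lemma trunc_le: "\<delta> > 0 \<Longrightarrow> y \<noteq> 0 \<Longrightarrow> trunc \<delta> y \<le> h \<bar>y\<bar>"
  using cutoff_bounds[of \<delta> "\<bar>y\<bar>"] pos[of "\<bar>y\<bar>"] by (simp add: trunc_eq mult_left_le_one_le)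

lemma trunc_tendsto: "y \<noteq> 0 \<Longrightarrow> (\<lambda>n. trunc (1 / real (Suc n)) y) \<longlonglongrightarrow> h \<bar>y\<bar>"
  using tendsto_mult[OF cutoff_tendsto[of "\<bar>y\<bar>"] tendsto_const[of "h \<bar>y\<bar>"]]
  by (simp add: trunc_eq)

lemma continuous_trunc: "\<delta> > 0 \<Longrightarrow> continuous_on S (trunc \<delta>)"
  unfolding trunc_def [abs_def] cutoff_def
  by (intro continuous_intros continuous_on_compose2[OF cont]) auto

lemma continuous_trunc_compose:
  assumes "\<delta> > 0" "continuous_on S f"
  shows "continuous_on S (\<lambda>x. trunc \<delta> (f x))"
  by (rule continuous_on_compose2[OF continuous_trunc[OF assms(1), of UNIV] assms(2)]) auto

lemma trunc_prim_deriv: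
  assumes "\<delta> > 0"
  shows "(trunc_prim \<delta> has_real_derivative trunc \<delta> y) (at y)"
proof -
  define B where "B = \<bar>y\<bar> + 1"
  have "((\<lambda>u. LBINT t=ereal 0..ereal u. trunc \<delta> t) has_vector_derivative trunc \<delta> y) (at y within {-B..B})"
    using assms by (intro interval_integral_FTC2 continuous_trunc) (auto simp: B_def)
  then have "(trunc_prim \<delta> has_real_derivative trunc \<delta> y) (at y within {-B..B})"
    by (simp add: trunc_prim_def [abs_def] has_real_derivative_iff_has_vector_derivative zero_ereal_def)
  moreover have "at y within {-B..B} = at y"
    by (rule at_within_interior) (auto simp: B_def)
  ultimately show ?thesis by simp
qed

lemma trunc_prim_minus: "trunc_prim \<delta> (- y) = - trunc_prim \<delta> y"
proof -
  have "trunc_prim \<delta> (- y) = (LBINT t=ereal y..0. trunc \<delta> (- t))"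
    unfolding trunc_prim_def by (subst interval_integral_reflect) simp
  also have "\<dots> = (LBINT t=ereal y..0. trunc \<delta> t)" by (simp add: trunc_def)
  also have "\<dots> = - trunc_prim \<delta> y"
    unfolding trunc_prim_def by (rule interval_integral_endpoints_reverse)
  finally show ?thesis .
qed

lemma trunc_prim_0 [simp]: "trunc_prim \<delta> 0 = 0"
  using trunc_prim_minus[of \<delta> 0] by simp

lemma trunc_prim_pos: "y \<ge> 0 \<Longrightarrow> trunc_prim \<delta> y = (LBINT t:{0<..<y}. trunc \<delta> t)"
proof -
  assume "y \<ge> 0"
  moreover have "einterval 0 (ereal y) = {0<..<y}" by (simp add: zero_ereal_def)
  ultimately show ?thesis
    unfolding trunc_prim_def by (subst interval_lebesgue_integral_le_eq) (auto simp: zero_ereal_def)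
qed

lemma trunc_measurable: "\<delta> > 0 \<Longrightarrow> trunc \<delta> \<in> borel_measurable borel"
  using continuous_trunc by (rule borel_measurable_continuous_onI)

lemma set_integrable_trunc:
  assumes "\<delta> > 0"
  shows "set_integrable lborel {0<..<y} (trunc \<delta>)"
proof (cases "y > 0")
  case True
  show ?thesis
  proof (rule set_integrable_bound[OF int[OF True]])
    show "set_borel_measurable lborel {0<..<y} (trunc \<delta>)"
      using trunc_measurable[OF assms] unfolding set_borel_measurable_def by simp
    have "norm (trunc \<delta> t) \<le> norm (h t)" if "t \<in> {0<..<y}" for t
      using that trunc_le[OF assms, of t] trunc_nonneg[OF assms, of t] by auto
    then show "AE t in lborel. t \<in> {0<..<y} \<longrightarrow> norm (trunc \<delta> t) \<le> norm (h t)" by simp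
  qed
qed (simp add: set_integrable_def)

lemma H_fun_nonneg: "0 \<le> H_fun h x"
  unfolding H_fun_def set_lebesgue_integral_def
  by (rule integral_nonneg_AE) (auto simp: indicator_def less_imp_le pos)

lemma H_fun_mono: "mono (H_fun h)"
proof (rule monoI)
  fix x y :: real assume "x \<le> y"
  show "H_fun h x \<le> H_fun h y"
  proof (cases "x > 0")
    case True
    with \<open>x \<le> y\<close> show ?thesis
      using int[of x] int[of y] unfolding H_fun_def set_lebesgue_integral_def set_integrable_def
      by (intro integral_mono) (auto simp: indicator_def less_imp_le pos)
  next
    case False
    then have "H_fun h x = 0" by (simp add: H_fun_def set_lebesgue_integral_def)
    then show ?thesis using H_fun_nonneg[of y] by simp
  qed
qed

text \<open>Truncation does not increase the quotient \<open>H / h\<close>, since the cutoff on \<open>(0, |y|)\<close> is at most its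
  value at \<open>|y|\<close>.\<close>

lemma trunc_prim_bound:
  assumes "\<delta> > 0"
  shows "\<bar>trunc_prim \<delta> y\<bar> \<le> trunc \<delta> y * T_fun h \<bar>y\<bar>"
proof (cases "y = 0")
  case False
  have sym: "\<bar>trunc_prim \<delta> y\<bar> = \<bar>trunc_prim \<delta> \<bar>y\<bar>\<bar>"
    by (cases "y \<ge> 0") (auto simp: trunc_prim_minus)
  have "trunc_prim \<delta> \<bar>y\<bar> = (LBINT t:{0<..<\<bar>y\<bar>}. trunc \<delta> t)" by (rule trunc_prim_pos) simp
  moreover have "\<dots> \<ge> 0"
    unfolding set_lebesgue_integral_def
    by (rule integral_nonneg_AE) (auto simp: trunc_nonneg assms)
  ultimately have "\<bar>trunc_prim \<delta> \<bar>y\<bar>\<bar> = (LBINT t:{0<..<\<bar>y\<bar>}. trunc \<delta> t)" by simp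
  also have "\<dots> \<le> (LBINT t:{0<..<\<bar>y\<bar>}. cutoff \<delta> \<bar>y\<bar> * h t)"
  proof (rule set_integral_mono)
    show "set_integrable lborel {0<..<\<bar>y\<bar>} (trunc \<delta>)" using assms by (rule set_integrable_trunc)
    show "set_integrable lborel {0<..<\<bar>y\<bar>} (\<lambda>t. cutoff \<delta> \<bar>y\<bar> * h t)"
      using int[of "\<bar>y\<bar>"] False by simp
    show "trunc \<delta> t \<le> cutoff \<delta> \<bar>y\<bar> * h t" if "t \<in> {0<..<\<bar>y\<bar>}" for t
      using that cutoff_mono[OF assms, of t "\<bar>y\<bar>"] pos[of t] assms
      by (auto simp: trunc_eq intro!: mult_right_mono)
  qed
  also have "\<dots> = cutoff \<delta> \<bar>y\<bar> * H_fun h \<bar>y\<bar>" by (simp add: H_fun_def)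
  also have "\<dots> = trunc \<delta> y * T_fun h \<bar>y\<bar>"
    using pos[of "\<bar>y\<bar>"] False assms by (simp add: trunc_eq T_fun_def)
  finally show ?thesis using sym by simp
qed (use assms in simp)

lemma trunc_prim_tendsto:
  "(\<lambda>n. trunc_prim (1 / real (Suc n)) y) \<longlonglongrightarrow> sgn y * H_ext h \<bar>y\<bar>"
proof -
  have *: "(\<lambda>n. trunc_prim (1 / real (Suc n)) y) \<longlonglongrightarrow> H_fun h y" if "y > 0" for y
  proof -
    have "(\<lambda>n. LBINT t:{0<..<y}. trunc (1 / real (Suc n)) t) \<longlonglongrightarrow> (LBINT t:{0<..<y}. h t)"
      unfolding set_lebesgue_integral_def
    proof (rule integral_dominated_convergence)
      show "integrable lborel (\<lambda>t. indicator {0<..<y} t *\<^sub>R h t)"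
        using int[OF that] by (simp add: set_integrable_def)
      then show "(\<lambda>t. indicator {0<..<y} t *\<^sub>R h t) \<in> borel_measurable lborel"
        by (rule borel_measurable_integrable)
      show "(\<lambda>t. indicator {0<..<y} t *\<^sub>R trunc (1 / real (Suc n)) t) \<in> borel_measurable lborel" for n
        using trunc_measurable[of "1 / real (Suc n)"] by simp
      have "(\<lambda>n. indicator {0<..<y} t *\<^sub>R trunc (1 / real (Suc n)) t) \<longlonglongrightarrow> indicator {0<..<y} t *\<^sub>R h t"
        for t
        using trunc_tendsto[of t] by (auto simp: indicator_def)
      then show "AE t in lborel. (\<lambda>n. indicator {0<..<y} t *\<^sub>R trunc (1 / real (Suc n)) t)
          \<longlonglongrightarrow> indicator {0<..<y} t *\<^sub>R h t" by simp
      show "AE t in lborel. norm (indicator {0<..<y} t *\<^sub>R trunc (1 / real (Suc n)) t)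
          \<le> indicator {0<..<y} t *\<^sub>R h t" for n
      proof (rule AE_I2)
        fix t
        have "norm (trunc (1 / real (Suc n)) t) \<le> h t" if "0 < t"
          using that trunc_le[of "1 / real (Suc n)" t] trunc_nonneg[of "1 / real (Suc n)" t] by simp
        then show "norm (indicator {0<..<y} t *\<^sub>R trunc (1 / real (Suc n)) t)
          \<le> indicator {0<..<y} t *\<^sub>R h t" by (auto simp: indicator_def)
      qed
    qed
    then show ?thesis using that by (simp add: trunc_prim_pos H_fun_def)
  qed
  consider "y > 0" | "y < 0" | "y = 0" by linarith
  then show ?thesis
  proof cases
    case 1
    then show ?thesis using * by (simp add: H_ext_def)
  next
    case 2
    then have "(\<lambda>n. - trunc_prim (1 / real (Suc n)) (- y)) \<longlonglongrightarrow> - H_fun h (- y)"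
      using * by (intro tendsto_minus) auto
    then show ?thesis using 2 by (simp add: trunc_prim_minus H_ext_def)
  qed simp
qed

end

section \<open>The estimate on compact intervals\<close>

lemma abs_continuous_on_increment_bound:
  assumes ac: "abs_continuous_on I g" and "A \<ge> 0"
    and bd: "\<And>u v. u \<le> v \<Longrightarrow> {u..v} \<subseteq> I \<Longrightarrow> \<bar>k v - k u\<bar> \<le> A * (\<bar>g v - g u\<bar> + \<bar>v - u\<bar>)"
  shows "abs_continuous_on I k"
  unfolding abs_continuous_on_def
proof (intro allI impI)
  fix \<epsilon> :: real assume "\<epsilon> > 0"
  define \<epsilon>' where "\<epsilon>' = \<epsilon> / (2 * (A + 1))"
  have \<epsilon>': "\<epsilon>' > 0" "A * (2 * \<epsilon>') < \<epsilon>"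
    using \<open>\<epsilon> > 0\<close> \<open>A \<ge> 0\<close> by (auto simp: \<epsilon>'_def field_simps)
  obtain \<delta> where "\<delta> > 0" and \<delta>: "\<And>(n::nat) u v. (\<forall>i<n. u i \<le> v i \<and> {u i..v i} \<subseteq> I) \<Longrightarrow>
        disjoint_family_on (\<lambda>i. {u i<..<v i}) {..<n} \<Longrightarrow> (\<Sum>i<n. v i - u i) < \<delta> \<Longrightarrow>
        (\<Sum>i<n. \<bar>g (v i) - g (u i)\<bar>) < \<epsilon>'"
    using ac \<epsilon>'(1) unfolding abs_continuous_on_def by meson
  show "\<exists>\<delta>>0. \<forall>(n::nat) u v.
      (\<forall>i<n. u i \<le> v i \<and> {u i..v i} \<subseteq> I) \<and>
      disjoint_family_on (\<lambda>i. {u i<..<v i}) {..<n} \<and> (\<Sum>i<n. v i - u i) < \<delta> \<longrightarrow>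
      (\<Sum>i<n. \<bar>k (v i) - k (u i)\<bar>) < \<epsilon>"
  proof (intro exI[of _ "min \<delta> \<epsilon>'"] conjI allI impI)
    show "min \<delta> \<epsilon>' > 0" using \<open>\<delta> > 0\<close> \<epsilon>' by simp
    fix n :: nat and u v
    assume *: "(\<forall>i<n. u i \<le> v i \<and> {u i..v i} \<subseteq> I) \<and>
      disjoint_family_on (\<lambda>i. {u i<..<v i}) {..<n} \<and> (\<Sum>i<n. v i - u i) < min \<delta> \<epsilon>'"
    then have "(\<Sum>i<n. \<bar>g (v i) - g (u i)\<bar>) < \<epsilon>'" by (intro \<delta>) auto
    moreover have "(\<Sum>i<n. \<bar>v i - u i\<bar>) = (\<Sum>i<n. v i - u i)" using * by (intro sum.cong) auto
    ultimately have "(\<Sum>i<n. \<bar>g (v i) - g (u i)\<bar> + \<bar>v i - u i\<bar>) \<le> 2 * \<epsilon>'"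
      using * by (simp add: sum.distrib)
    then have "A * (\<Sum>i<n. \<bar>g (v i) - g (u i)\<bar> + \<bar>v i - u i\<bar>) \<le> A * (2 * \<epsilon>')"
      using \<open>A \<ge> 0\<close> by (rule mult_left_mono)
    moreover have "(\<Sum>i<n. \<bar>k (v i) - k (u i)\<bar>) \<le> A * (\<Sum>i<n. \<bar>g (v i) - g (u i)\<bar> + \<bar>v i - u i\<bar>)"
      unfolding sum_distrib_left using * by (intro sum_mono bd) auto
    ultimately show "(\<Sum>i<n. \<bar>k (v i) - k (u i)\<bar>) < \<epsilon>" using \<epsilon>' by linarith
  qed
qed

lemma C1_lipschitz_on_compact_interval:
  fixes g g' :: "real \<Rightarrow> real"
  assumes "\<And>x. x \<in> {r..R} \<Longrightarrow> (g has_real_derivative g' x) (at x)" "continuous_on {r..R} g'"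
  shows "\<exists>C\<ge>0. \<forall>u\<in>{r..R}. \<forall>v\<in>{r..R}. \<bar>g v - g u\<bar> \<le> C * \<bar>v - u\<bar>"
proof -
  have "bounded (g' ` {r..R})"
    using assms(2) by (intro compact_imp_bounded compact_continuous_image) auto
  then obtain C where C: "C > 0" "\<And>x. x \<in> {r..R} \<Longrightarrow> norm (g' x) \<le> C"
    unfolding bounded_pos by auto
  have "norm (g v - g u) \<le> C * norm (v - u)" if "u \<in> {r..R}" "v \<in> {r..R}" for u v
    using that C(2) assms(1)
    by (intro field_differentiable_bound[of "{r..R}" g g'])
      (auto intro: has_field_derivative_at_within)
  then show ?thesis using C(1) by (intro exI[of _ C]) auto
qed

context weight
begin

lemma T_fun_nonneg: "0 \<le> T_fun h \<bar>y\<bar>"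
proof (cases "y = 0")
  case True
  then show ?thesis by (simp add: T_fun_def H_fun_def set_lebesgue_integral_def)
next
  case False
  then show ?thesis using H_fun_nonneg[of "\<bar>y\<bar>"] pos[of "\<bar>y\<bar>"] by (simp add: T_fun_def)
qed

text \<open>The truncated boundary term; absolute continuity is inherited from \<open>f'\<close>, because its increments
  are at most a constant multiple of those of \<open>f'\<close> and of the identity.\<close>

lemma abs_continuous_boundary_term:
  assumes p: "p \<ge> 2" and "\<delta> > 0"
    and f: "\<And>x. x \<in> {r..R} \<Longrightarrow> (f has_real_derivative f' x) (at x)"
    and f'c: "continuous_on {r..R} f'" and ac: "abs_continuous_on {r..R} f'"
  shows "abs_continuous_on {r..R} (\<lambda>x. signed_power p (f' x) * trunc_prim \<delta> (f x))"
proof -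
  let ?H = "\<lambda>x. trunc_prim \<delta> (f x)"
  have fc: "continuous_on {r..R} f"
    using f by (intro DERIV_continuous_on) (blast intro: has_field_derivative_at_within)
  have H: "(?H has_real_derivative trunc \<delta> (f x) * f' x) (at x)" if "x \<in> {r..R}" for x
    using DERIV_chain2[OF trunc_prim_deriv[OF \<open>\<delta> > 0\<close>] f[OF that]] .
  have "continuous_on {r..R} (\<lambda>x. trunc \<delta> (f x) * f' x)"
    by (intro continuous_on_mult continuous_trunc_compose[OF \<open>\<delta> > 0\<close>] fc f'c)
  then obtain C1 where C1: "C1 \<ge> 0"
    "\<forall>u\<in>{r..R}. \<forall>v\<in>{r..R}. \<bar>?H v - ?H u\<bar> \<le> C1 * \<bar>v - u\<bar>"
    using C1_lipschitz_on_compact_interval[OF H] by blast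
  have "bounded (f' ` {r..R})"
    using f'c by (intro compact_imp_bounded compact_continuous_image) auto
  then obtain M where M: "M > 0" "\<And>x. x \<in> {r..R} \<Longrightarrow> \<bar>f' x\<bar> \<le> M"
    unfolding bounded_pos by auto
  obtain C2 where C2: "C2 \<ge> 0"
    "\<And>y z. \<bar>y\<bar> \<le> M \<Longrightarrow> \<bar>z\<bar> \<le> M \<Longrightarrow> \<bar>signed_power p y - signed_power p z\<bar> \<le> C2 * \<bar>y - z\<bar>"
    using signed_power_lipschitz[OF p, of M] by blast
  have "continuous_on {r..R} ?H"
    using H by (intro DERIV_continuous_on) (blast intro: has_field_derivative_at_within)
  then have "bounded (?H ` {r..R})"
    by (intro compact_imp_bounded compact_continuous_image) auto
  then obtain C3 where C3: "C3 > 0" "\<And>x. x \<in> {r..R} \<Longrightarrow> \<bar>?H x\<bar> \<le> C3"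
    unfolding bounded_pos by auto
  have sp0: "signed_power p 0 = 0" by (simp add: signed_power_def)
  show ?thesis
  proof (rule abs_continuous_on_increment_bound[OF ac])
    show "0 \<le> C2 * C3 + C2 * M * C1" using C1 C2 C3 M by simp
    fix u v :: real assume "u \<le> v" "{u..v} \<subseteq> {r..R}"
    then have uv: "u \<in> {r..R}" "v \<in> {r..R}" by auto
    let ?S = "\<lambda>x. signed_power p (f' x)"
    have "?S v * ?H v - ?S u * ?H u = (?S v - ?S u) * ?H v + ?S u * (?H v - ?H u)"
      by (simp add: algebra_simps)
    also have "\<bar>\<dots>\<bar> \<le> \<bar>?S v - ?S u\<bar> * \<bar>?H v\<bar> + \<bar>?S u\<bar> * \<bar>?H v - ?H u\<bar>"
      by (metis abs_mult abs_triangle_ineq)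
    also have "\<dots> \<le> (C2 * \<bar>f' v - f' u\<bar>) * C3 + (C2 * M) * (C1 * \<bar>v - u\<bar>)"
    proof (intro add_mono mult_mono)
      show "\<bar>?S v - ?S u\<bar> \<le> C2 * \<bar>f' v - f' u\<bar>" using C2(2) M(2) uv by blast
      have "\<bar>?S u\<bar> \<le> C2 * \<bar>f' u\<bar>" using C2(2)[of "f' u" 0] M uv sp0 by auto
      also have "\<dots> \<le> C2 * M" using M(2)[OF uv(1)] C2(1) by (rule mult_left_mono)
      finally show "\<bar>?S u\<bar> \<le> C2 * M" .
    qed (use C1 C2 C3 M uv in auto)
    also have "\<dots> \<le> (C2 * C3 + C2 * M * C1) * (\<bar>f' v - f' u\<bar> + \<bar>v - u\<bar>)"
    proof -
      have "0 \<le> (C2 * M * C1) * \<bar>f' v - f' u\<bar>" "0 \<le> (C2 * C3) * \<bar>v - u\<bar>"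
        using C1 C2 C3 M by auto
      then show ?thesis by (simp add: algebra_simps)
    qed
    finally show "\<bar>?S v * ?H v - ?S u * ?H u\<bar>
      \<le> (C2 * C3 + C2 * M * C1) * (\<bar>f' v - f' u\<bar> + \<bar>v - u\<bar>)" .
  qed
qed

text \<open>Stated for the completed measure, because the measurability of the second derivative is read off
  from its Henstock-Kurzweil integrability.\<close>

lemma integrand_measurable:
  assumes F: "F \<in> borel_measurable lebesgue" and D: "D \<in> borel_measurable lebesgue"
  shows "(\<lambda>x. if F x \<noteq> 0 then \<bar>D x * T_fun h \<bar>F x\<bar>\<bar> powr q * h \<bar>F x\<bar> else 0)
    \<in> borel_measurable lebesgue"
proof -
  define hb where "hb y = indicator {0<..} y *\<^sub>R h y" for y
  have hb: "hb \<in> borel_measurable borel"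
    unfolding hb_def by (rule borel_measurable_continuous_on_indicator) (auto intro: cont)
  note [measurable] = F D hb borel_measurable_mono[OF H_fun_mono]
  have eq: "(\<lambda>x. if F x \<noteq> 0 then \<bar>D x * T_fun h \<bar>F x\<bar>\<bar> powr q * h \<bar>F x\<bar> else 0) =
      (\<lambda>x. if F x \<noteq> 0 then \<bar>D x * (H_fun h \<bar>F x\<bar> / hb \<bar>F x\<bar>)\<bar> powr q * hb \<bar>F x\<bar> else 0)"
    by (auto simp: T_fun_def hb_def)
  show ?thesis unfolding eq by measurable
qed

text \<open>The hypothesis on \<open>y\<close> says that the right-hand integral over \<open>{r..R}\<close> is finite with value \<open>y\<close>.\<close>

lemma truncated_estimate:
  assumes p: "p \<ge> 2" and f: "f \<in> W21_loc I" and "open I" and rR: "r \<le> R" "{r..R} \<subseteq> I" and "\<delta> > 0"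
    and y: "(\<integral>\<^sup>+x\<in>{r..R} \<inter> {x. f x \<noteq> 0}.
        ennreal (\<bar>deriv (deriv f) x * T_fun h \<bar>f x\<bar>\<bar> powr (p / 2) * h \<bar>f x\<bar>) \<partial>lborel) = ennreal y" "y \<ge> 0"
  shows "integral {r..R} (\<lambda>x. \<bar>deriv f x\<bar> powr p * trunc \<delta> (f x))
    \<le> p / 2 * (signed_power p (deriv f R) * trunc_prim \<delta> (f R)
             - signed_power p (deriv f r) * trunc_prim \<delta> (f r)) + sqrt (p - 1) powr p * y"
proof -
  define f1 f2 where "f1 = deriv f" and "f2 = deriv f1"
  have fd: "(f has_real_derivative f1 x) (at x)" if "x \<in> {r..R}" for x
    using f that rR(2) unfolding W21_loc_def f1_def
    by (auto simp: DERIV_deriv_iff_real_differentiable)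
  have f1c: "continuous_on {r..R} f1" and ac: "abs_continuous_on {r..R} f1"
    and lac: "loc_abs_continuous_on I f1"
    using f rR(2) unfolding W21_loc_def f1_def loc_abs_continuous_on_def
    by (auto intro: continuous_on_subset)
  have fc: "continuous_on {r..R} f"
    using fd by (intro DERIV_continuous_on) (blast intro: has_field_derivative_at_within)
  define N where "N = {x\<in>I. \<not> f1 differentiable (at x)}"
  have N: "negligible N"
    unfolding N_def by (rule loc_abs_continuous_on_differentiable_ae[OF lac \<open>open I\<close>])
  have f1d: "(f1 has_real_derivative f2 x) (at x)" if "x \<in> {r..R} - N" for x
    using that rR(2) unfolding N_def f2_def by (auto simp: DERIV_deriv_iff_real_differentiable)
  have f2int: "(f2 has_integral f1 R - f1 r) {r..R}"
    using f1d by (intro abs_continuous_has_integral_derivative[OF rR(1) ac N])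
      (blast intro: has_field_derivative_at_within)
  define B where "B x = signed_power p (f1 x) * trunc_prim \<delta> (f x)" for x
  define J where "J x = \<bar>f1 x\<bar> powr p * trunc \<delta> (f x)" for x
  define G where "G x = signed_power_deriv p (f1 x) * f2 x * trunc_prim \<delta> (f x) + J x" for x
  have "abs_continuous_on {r..R} B"
    unfolding B_def using abs_continuous_boundary_term[OF p \<open>\<delta> > 0\<close> fd f1c ac] by simp
  then have Gint: "(G has_integral B R - B r) {r..R}"
  proof (rule abs_continuous_has_integral_derivative[OF rR(1) _ N])
    fix x assume x: "x \<in> {r..R} - N"
    have "((\<lambda>x. signed_power p (f1 x)) has_real_derivative signed_power_deriv p (f1 x) * f2 x) (at x)"
      by (rule DERIV_chain2[OF has_real_derivative_signed_power[OF p] f1d[OF x]])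
    moreover have "((\<lambda>x. trunc_prim \<delta> (f x)) has_real_derivative trunc \<delta> (f x) * f1 x) (at x)"
      using x by (intro DERIV_chain2[OF trunc_prim_deriv[OF \<open>\<delta> > 0\<close>] fd]) auto
    ultimately have "(B has_real_derivative signed_power_deriv p (f1 x) * f2 x * trunc_prim \<delta> (f x)
        + trunc \<delta> (f x) * f1 x * signed_power p (f1 x)) (at x)"
      unfolding B_def by (rule DERIV_mult)
    also have "trunc \<delta> (f x) * f1 x * signed_power p (f1 x) = J x"
      using signed_power_mult_self[OF p, of "f1 x"] by (simp add: J_def mult_ac)
    finally show "(B has_real_derivative G x) (at x within {r..R})"
      unfolding G_def by (rule has_field_derivative_at_within)
  qed
  have "continuous_on {r..R} J"
    unfolding J_def using p
    by (intro continuous_on_mult continuous_trunc_compose[OF \<open>\<delta> > 0\<close>] fc f1c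
        continuous_on_powr' continuous_on_rabs continuous_on_const) auto
  then have Jint: "(J has_integral integral {r..R} J) {r..R}"
    by (intro integrable_integral integrable_continuous_real)
  define F where "F x = indicator {r..R} x *\<^sub>R f x" for x
  define k where "k x = (if F x \<noteq> 0 then
    \<bar>(f2 x * indicator {r..R} x) * T_fun h \<bar>F x\<bar>\<bar> powr (p / 2) * h \<bar>F x\<bar> else 0)" for x
  have "F \<in> borel_measurable borel"
    unfolding F_def by (rule borel_measurable_continuous_on_indicator[OF _ fc]) simp
  then have F: "F \<in> borel_measurable lebesgue" by (simp add: measurable_completion)
  have km: "k \<in> borel_measurable lebesgue"
    unfolding k_def
    by (rule integrand_measurable[OF F has_integral_implies_lebesgue_measurable_real[OF f2int]])
  have k0: "0 \<le> k x" for x using pos by (auto simp: k_def less_imp_le)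
  have "(\<integral>\<^sup>+x. ennreal (k x) \<partial>lborel) = ennreal y"
    unfolding y(1)[symmetric]
    by (intro nn_integral_cong) (auto simp: k_def F_def f1_def f2_def indicator_def)
  then have "(k has_integral y) UNIV"
    using km y(2) by (simp add: has_integral_iff_nn_integral_lebesgue[OF k0] nn_integral_completion)
  moreover have "(\<lambda>x. if x \<in> {r..R} then k x else 0) = k" by (auto simp: k_def F_def)
  ultimately have kint: "(k has_integral y) {r..R}"
    using has_integral_restrict_UNIV[of "{r..R}" k y] by simp
  define C where "C = sqrt (p - 1) powr p"
  have "integral {r..R} J - C * y \<le> p / 2 * (B R - B r)"
  proof (rule has_integral_le)
    show "((\<lambda>x. J x - C * k x) has_integral integral {r..R} J - C * y) {r..R}"
      using Jint kint by (intro has_integral_diff has_integral_mult_right)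
    show "((\<lambda>x. p / 2 * G x) has_integral p / 2 * (B R - B r)) {r..R}"
      using Gint by (rule has_integral_mult_right)
    fix x assume x: "x \<in> {r..R}"
    \<comment> \<open>Pointwise Young inequality, weighted with the truncated weight.\<close>
    let ?t = "\<bar>f2 x\<bar> * T_fun h \<bar>f x\<bar>" and ?d = "signed_power_deriv p (f1 x)"
    have t0: "?t \<ge> 0" using T_fun_nonneg by simp
    have d0: "?d \<ge> 0" using p by (simp add: signed_power_deriv_def)
    have tk: "trunc \<delta> (f x) * ?t powr (p / 2) \<le> k x"
    proof (cases "f x = 0")
      case True
      then show ?thesis using k0 \<open>\<delta> > 0\<close> by simp
    next
      case False
      have "trunc \<delta> (f x) * ?t powr (p / 2) \<le> h \<bar>f x\<bar> * ?t powr (p / 2)"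
        using trunc_le[OF \<open>\<delta> > 0\<close> False] by (rule mult_right_mono) simp
      also have "\<dots> = k x"
        using x False T_fun_nonneg[of "f x"] by (simp add: k_def F_def abs_mult mult.commute)
      finally show ?thesis .
    qed
    have "\<bar>?d * f2 x * trunc_prim \<delta> (f x)\<bar> = ?d * \<bar>f2 x\<bar> * \<bar>trunc_prim \<delta> (f x)\<bar>"
      using d0 by (simp add: abs_mult)
    also have "\<dots> \<le> ?d * \<bar>f2 x\<bar> * (trunc \<delta> (f x) * T_fun h \<bar>f x\<bar>)"
      using trunc_prim_bound[OF \<open>\<delta> > 0\<close>] d0 by (intro mult_left_mono) auto
    finally have "p / 2 * \<bar>?d * f2 x * trunc_prim \<delta> (f x)\<bar> \<le> p / 2 * (?d * \<bar>f2 x\<bar> * (trunc \<delta> (f x) * T_fun h \<bar>f x\<bar>))"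
      using p by (intro mult_left_mono) auto
    also have "\<dots> = trunc \<delta> (f x) * (p / 2 * (?d * ?t))" by (simp add: mult_ac)
    also have "\<dots> \<le> trunc \<delta> (f x) * ((p / 2 - 1) * \<bar>f1 x\<bar> powr p + C * ?t powr (p / 2))"
      unfolding C_def
      by (rule mult_left_mono[OF signed_power_deriv_young[OF p t0] trunc_nonneg[OF \<open>\<delta> > 0\<close>]])
    also have "\<dots> = (p / 2 - 1) * J x + C * (trunc \<delta> (f x) * ?t powr (p / 2))"
      by (simp add: J_def algebra_simps)
    also have "\<dots> \<le> (p / 2 - 1) * J x + C * k x"
      using mult_left_mono[OF tk, of C] by (simp add: C_def)
    finally have "p / 2 * \<bar>?d * f2 x * trunc_prim \<delta> (f x)\<bar> \<le> (p / 2 - 1) * J x + C * k x" .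
    moreover have "- (p / 2 * \<bar>?d * f2 x * trunc_prim \<delta> (f x)\<bar>) \<le> p / 2 * (?d * f2 x * trunc_prim \<delta> (f x))"
      using p mult_left_mono[of "- \<bar>?d * f2 x * trunc_prim \<delta> (f x)\<bar>" "?d * f2 x * trunc_prim \<delta> (f x)" "p / 2"]
      by (simp add: abs_le_D2)
    moreover have "p / 2 * G x = p / 2 * (?d * f2 x * trunc_prim \<delta> (f x)) + p / 2 * J x"
      by (simp only: G_def distrib_left)
    moreover have "(p / 2 - 1) * J x = p / 2 * J x - J x" by (simp add: algebra_simps)
    ultimately show "J x - C * k x \<le> p / 2 * G x" by linarith
  qed
  then show ?thesis unfolding J_def B_def C_def f1_def by simp
qed

text \<open>Fatou's lemma along \<open>\<delta> = 1 / (n + 1)\<close> replaces the truncated weight by \<open>h\<close>.\<close>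

lemma compact_interval_estimate:
  assumes p: "p \<ge> 2" and f: "f \<in> W21_loc I" and "open I" and rR: "r \<le> R" "{r..R} \<subseteq> I"
    and y: "(\<integral>\<^sup>+x\<in>{r..R} \<inter> {x. f x \<noteq> 0}.
        ennreal (\<bar>deriv (deriv f) x * T_fun h \<bar>f x\<bar>\<bar> powr (p / 2) * h \<bar>f x\<bar>) \<partial>lborel) = ennreal y" "y \<ge> 0"
  shows "(\<integral>\<^sup>+x\<in>{r..R} \<inter> {x. f x \<noteq> 0}. ennreal (\<bar>deriv f x\<bar> powr p * h \<bar>f x\<bar>) \<partial>lborel)
    \<le> ennreal (p / 2 * (boundary_term p h f R - boundary_term p h f r) + sqrt (p - 1) powr p * y)"
proof -
  define \<delta> where "\<delta> n = 1 / real (Suc n)" for n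
  have \<delta>: "\<delta> n > 0" for n by (simp add: \<delta>_def)
  define J where "J n x = \<bar>deriv f x\<bar> powr p * trunc (\<delta> n) (f x)" for n x
  define b where "b n = p / 2 * (signed_power p (deriv f R) * trunc_prim (\<delta> n) (f R)
             - signed_power p (deriv f r) * trunc_prim (\<delta> n) (f r)) + sqrt (p - 1) powr p * y" for n
  have fd: "(f has_real_derivative deriv f x) (at x)" if "x \<in> {r..R}" for x
    using f that rR(2) unfolding W21_loc_def
    by (auto simp: DERIV_deriv_iff_real_differentiable)
  have fc: "continuous_on {r..R} f"
    using fd by (intro DERIV_continuous_on) (auto intro: has_field_derivative_at_within)
  have f1c: "continuous_on {r..R} (deriv f)"
    using f rR(2) unfolding W21_loc_def by (auto intro: continuous_on_subset)
  have Jc: "continuous_on {r..R} (J n)" for n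
    unfolding J_def using p
    by (intro continuous_on_mult continuous_trunc_compose[OF \<delta>] fc f1c
        continuous_on_powr' continuous_on_rabs continuous_on_const) auto
  have J0: "0 \<le> J n x" for n x unfolding J_def using trunc_nonneg[OF \<delta>] by simp
  define u where "u n x = ennreal (indicator {r..R} x * J n x)" for n x
  have um: "u n \<in> borel_measurable lborel" for n
    using borel_measurable_continuous_on_indicator[OF _ Jc[of n]] unfolding u_def by simp
  have ui: "(\<integral>\<^sup>+x. u n x \<partial>lborel) \<le> ennreal (b n)" for n
  proof -
    have "(J n has_integral integral {r..R} (J n)) {r..R}"
      by (intro integrable_integral integrable_continuous_real Jc)
    then have "(\<integral>\<^sup>+x. u n x \<partial>lborel) = ennreal (integral {r..R} (J n))"
      unfolding u_def by (intro nn_integral_has_integral_lebesgue J0)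
    also have "\<dots> \<le> ennreal (b n)"
      unfolding J_def b_def by (intro ennreal_leI truncated_estimate[OF p f \<open>open I\<close> rR \<delta> y])
    finally show ?thesis .
  qed
  have "b \<longlonglongrightarrow> p / 2 * (signed_power p (deriv f R) * (sgn (f R) * H_ext h \<bar>f R\<bar>)
      - signed_power p (deriv f r) * (sgn (f r) * H_ext h \<bar>f r\<bar>)) + sqrt (p - 1) powr p * y"
    unfolding b_def \<delta>_def
    by (intro tendsto_add tendsto_mult tendsto_diff tendsto_const trunc_prim_tendsto)
  then have b: "b \<longlonglongrightarrow> p / 2 * (boundary_term p h f R - boundary_term p h f r) + sqrt (p - 1) powr p * y"
    by (simp add: boundary_term_def signed_power_def mult.assoc)
  have "(\<integral>\<^sup>+x\<in>{r..R} \<inter> {x. f x \<noteq> 0}. ennreal (\<bar>deriv f x\<bar> powr p * h \<bar>f x\<bar>) \<partial>lborel)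
      \<le> (\<integral>\<^sup>+x. liminf (\<lambda>n. u n x) \<partial>lborel)"
  proof (rule nn_integral_mono)
    fix x
    show "ennreal (\<bar>deriv f x\<bar> powr p * h \<bar>f x\<bar>) * indicator ({r..R} \<inter> {x. f x \<noteq> 0}) x
        \<le> liminf (\<lambda>n. u n x)"
    proof (cases "x \<in> {r..R} \<and> f x \<noteq> 0")
      case True
      have "(\<lambda>n. u n x) \<longlonglongrightarrow> ennreal (1 * (\<bar>deriv f x\<bar> powr p * h \<bar>f x\<bar>))"
        unfolding u_def J_def \<delta>_def using True
        by (intro tendsto_ennrealI tendsto_mult tendsto_const trunc_tendsto) auto
      then have "liminf (\<lambda>n. u n x) = ennreal (\<bar>deriv f x\<bar> powr p * h \<bar>f x\<bar>)"
        by (simp add: lim_imp_Liminf)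
      then show ?thesis using True by simp
    qed auto
  qed
  also have "\<dots> \<le> liminf (\<lambda>n. \<integral>\<^sup>+x. u n x \<partial>lborel)"
    by (rule nn_integral_liminf[OF um])
  also have "\<dots> \<le> liminf (\<lambda>n. ennreal (b n))"
    by (rule Liminf_mono) (simp add: ui)
  also have "\<dots> = ennreal (p / 2 * (boundary_term p h f R - boundary_term p h f r) + sqrt (p - 1) powr p * y)"
    by (rule lim_imp_Liminf) (use b tendsto_ennrealI in auto)
  finally show ?thesis .
qed

end

section \<open>Boundary behaviour and exhaustion of the interval\<close>

lemma boundary_term_right_endpoint:
  assumes "f \<in> R0_tilde p h a b" "ereal c < b" "\<epsilon> > 0"
  obtains R where "c < R" "ereal R < b" "boundary_term p h f R < \<epsilon>"
proof (rule ccontr)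
  assume *: "\<not> thesis"
  have "\<forall>\<^sub>F R in at_left b. ereal \<epsilon> \<le> ereal (boundary_term p h f (real_of_ereal R))"
    unfolding eventually_at_left[OF assms(2)]
  proof (intro exI[of _ "ereal c"] conjI allI impI assms(2))
    fix R assume R: "ereal c < R" "R < b"
    then obtain R' where "R = ereal R'" by (cases R) auto
    then show "ereal \<epsilon> \<le> ereal (boundary_term p h f (real_of_ereal R))"
      using R * that[of R'] by force
  qed
  then have "ereal \<epsilon> \<le> Liminf (at_left b) (\<lambda>R. ereal (boundary_term p h f (real_of_ereal R)))"
    by (rule Liminf_bounded)
  also have "\<dots> \<le> 0" using assms(1) by (simp add: R0_tilde_def)
  finally show False using \<open>\<epsilon> > 0\<close> by (simp add: zero_ereal_def)
qed

lemma boundary_term_left_endpoint: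
  assumes "f \<in> R0_tilde p h a b" "a < ereal c" "\<epsilon> > 0"
  obtains r where "r < c" "a < ereal r" "boundary_term p h f r > - \<epsilon>"
proof (rule ccontr)
  assume *: "\<not> thesis"
  have "\<forall>\<^sub>F r in at_right a. ereal (boundary_term p h f (real_of_ereal r)) \<le> ereal (- \<epsilon>)"
    unfolding eventually_at_right[OF assms(2)]
  proof (intro exI[of _ "ereal c"] conjI allI impI assms(2))
    fix r assume r: "a < r" "r < ereal c"
    then obtain r' where "r = ereal r'" by (cases r) auto
    then show "ereal (boundary_term p h f (real_of_ereal r)) \<le> ereal (- \<epsilon>)"
      using r * that[of r'] by force
  qed
  then have "Limsup (at_right a) (\<lambda>r. ereal (boundary_term p h f (real_of_ereal r))) \<le> ereal (- \<epsilon>)"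
    by (rule Limsup_bounded)
  moreover have "0 \<le> Limsup (at_right a) (\<lambda>r. ereal (boundary_term p h f (real_of_ereal r)))"
    using assms(1) by (simp add: R0_tilde_def)
  ultimately have "0 \<le> ereal (- \<epsilon>)" by (rule order_trans[rotated])
  then show False using \<open>\<epsilon> > 0\<close> by (simp add: zero_ereal_def)
qed

lemma nn_integral_einterval_le:
  fixes a b :: ereal and k :: "real \<Rightarrow> ennreal"
  assumes "a < b" and k: "(\<lambda>x. k x * indicator (einterval a b) x) \<in> borel_measurable lborel"
    and le: "\<And>c d. c \<le> d \<Longrightarrow> {c..d} \<subseteq> einterval a b \<Longrightarrow> (\<integral>\<^sup>+x\<in>{c..d}. k x \<partial>lborel) \<le> M"
  shows "(\<integral>\<^sup>+x\<in>einterval a b. k x \<partial>lborel) \<le> M"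
proof -
  obtain u l :: "nat \<Rightarrow> real" where ul: "einterval a b = (\<Union>i. {l i .. u i})"
    "incseq u" "decseq l" "\<And>i. l i < u i"
    by (rule einterval_Icc_approximation[OF \<open>a < b\<close>]) (rule that)
  have sub: "{l i..u i} \<subseteq> einterval a b" for i using ul(1) by auto
  have eq: "k x * indicator {l i..u i} x = (k x * indicator (einterval a b) x) * indicator {l i..u i} x"
    for x i using sub[of i] by (auto simp: indicator_def)
  have "(\<integral>\<^sup>+x\<in>einterval a b. k x \<partial>lborel) = (\<integral>\<^sup>+x. (SUP i. k x * indicator {l i..u i} x) \<partial>lborel)"
  proof (rule nn_integral_cong)
    fix x
    show "k x * indicator (einterval a b) x = (SUP i. k x * indicator {l i..u i} x)"
    proof (cases "x \<in> einterval a b")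
      case True
      then obtain i where "x \<in> {l i..u i}" using ul(1) by auto
      then have "k x \<le> (SUP i. k x * indicator {l i..u i} x)"
        by (intro SUP_upper2[of i]) auto
      moreover have "(SUP i. k x * indicator {l i..u i} x) \<le> k x"
        by (rule SUP_least) (auto simp: indicator_def)
      ultimately show ?thesis using True by simp
    next
      case False
      then have "x \<notin> {l i..u i}" for i using sub by blast
      then have "(SUP i. k x * indicator {l i..u i} x) = (SUP i::nat. 0)" by (intro SUP_cong) auto
      then show ?thesis using False by simp
    qed
  qed
  also have "\<dots> = (SUP i. \<integral>\<^sup>+x\<in>{l i..u i}. k x \<partial>lborel)"
  proof (rule nn_integral_monotone_convergence_SUP)
    show "incseq (\<lambda>i x. k x * indicator {l i..u i} x)"
    proof (rule incseq_SucI, rule le_funI)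
      fix i x
      have "{l i..u i} \<subseteq> {l (Suc i)..u (Suc i)}"
        using ul(2,3) by (auto intro: incseq_SucD decseq_SucD order_trans)
      then show "k x * indicator {l i..u i} x \<le> k x * indicator {l (Suc i)..u (Suc i)} x"
        by (intro mult_left_mono) (auto simp: indicator_def)
    qed
    show "(\<lambda>x. k x * indicator {l i..u i} x) \<in> borel_measurable lborel" for i
      unfolding eq using k by measurable
  qed
  also have "\<dots> \<le> M" by (rule SUP_least, rule le[OF less_imp_le[OF ul(4)] sub])
  finally show ?thesis .
qed

theorem proposition5p2:
  fixes p :: real and a b :: ereal and h f :: "real \<Rightarrow> real"
  assumes "p \<ge> 2" and "a < b"
    and "continuous_on {0<..} h"
    and "\<And>x. x > 0 \<Longrightarrow> h x > 0"
    and "\<And>\<epsilon>. \<epsilon> > 0 \<Longrightarrow> set_integrable lborel {0<..<\<epsilon>} h"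
    and "f \<in> R0_tilde p h a b"
  shows "(\<integral>\<^sup>+x\<in>einterval a b \<inter> {x. f x \<noteq> 0}.
            ennreal (\<bar>deriv f x\<bar> powr p * h \<bar>f x\<bar>) \<partial>lborel)
         \<le> ennreal (sqrt (p - 1) powr p) *
           (\<integral>\<^sup>+x\<in>einterval a b \<inter> {x. f x \<noteq> 0}.
              ennreal (\<bar>deriv (deriv f) x * T_fun h \<bar>f x\<bar>\<bar> powr (p / 2) * h \<bar>f x\<bar>) \<partial>lborel)"
proof -
  interpret weight h by unfold_locales (use assms in auto)
  let ?I = "einterval a b" and ?Z = "{x. f x \<noteq> 0}"
  define C where "C = sqrt (p - 1) powr p"
  define k1 where "k1 x = ennreal (\<bar>deriv f x\<bar> powr p * h \<bar>f x\<bar>)" for x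
  define k2 where "k2 x = ennreal (\<bar>deriv (deriv f) x * T_fun h \<bar>f x\<bar>\<bar> powr (p / 2) * h \<bar>f x\<bar>)" for x
  define Y where "Y = (\<integral>\<^sup>+x\<in>?I \<inter> ?Z. k2 x \<partial>lborel)"
  have C: "C > 0" using \<open>p \<ge> 2\<close> by (simp add: C_def)
  have f: "f \<in> W21_loc ?I" using assms(6) by (simp add: R0_tilde_def)
  have "(\<integral>\<^sup>+x\<in>?I \<inter> ?Z. k1 x \<partial>lborel) \<le> ennreal C * Y"
  proof (cases "Y = \<infinity>")
    case True
    then show ?thesis using C by (simp add: ennreal_mult_top)
  next
    case False
    then obtain Y' where Y': "Y = ennreal Y'" "Y' \<ge> 0" by (cases Y) auto
    have compact: "(\<integral>\<^sup>+x\<in>{c..d}. k1 x * indicator ?Z x \<partial>lborel) \<le> ennreal (C * Y')"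
      if cd: "c \<le> d" "{c..d} \<subseteq> ?I" for c d
    proof (rule ennreal_le_epsilon)
      fix e :: real assume "e > 0"
      \<comment> \<open>The boundary terms at \<open>R\<close> and \<open>r\<close> contribute at most \<open>p / 2 * (2 * \<epsilon>) = e\<close>.\<close>
      define \<epsilon> where "\<epsilon> = e / p"
      have \<epsilon>: "\<epsilon> > 0" using \<open>e > 0\<close> \<open>p \<ge> 2\<close> by (simp add: \<epsilon>_def)
      have "c \<in> ?I" "d \<in> ?I" using cd by auto
      then have "a < ereal c" "ereal d < b" by (auto simp: einterval_def)
      obtain R where R: "d < R" "ereal R < b" "boundary_term p h f R < \<epsilon>"
        using boundary_term_right_endpoint[OF assms(6) \<open>ereal d < b\<close> \<epsilon>] by blast
      obtain r where r: "r < c" "a < ereal r" "boundary_term p h f r > - \<epsilon>"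
        using boundary_term_left_endpoint[OF assms(6) \<open>a < ereal c\<close> \<epsilon>] by blast
      have sub: "{r..R} \<subseteq> ?I"
      proof
        fix x assume "x \<in> {r..R}"
        then have "ereal r \<le> ereal x" "ereal x \<le> ereal R" by auto
        then show "x \<in> ?I"
          using R(2) r(2) less_le_trans[of a "ereal r"] le_less_trans[of "ereal x" "ereal R"]
          by (simp add: einterval_def)
      qed
      have "r \<le> R" using r R cd by simp
      have le: "(\<integral>\<^sup>+x\<in>{r..R} \<inter> ?Z. k2 x \<partial>lborel) \<le> Y"
        unfolding Y_def using sub by (intro nn_integral_mono mult_left_mono) (auto simp: indicator_def)
      then obtain y where y: "(\<integral>\<^sup>+x\<in>{r..R} \<inter> ?Z. k2 x \<partial>lborel) = ennreal y" "y \<ge> 0"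
        using Y' by (cases "\<integral>\<^sup>+x\<in>{r..R} \<inter> ?Z. k2 x \<partial>lborel") (auto simp: top_unique)
      have "y \<le> Y'" using le y Y' by (simp add: ennreal_le_iff)
      have "(\<integral>\<^sup>+x\<in>{c..d}. k1 x * indicator ?Z x \<partial>lborel) \<le> (\<integral>\<^sup>+x\<in>{r..R} \<inter> ?Z. k1 x \<partial>lborel)"
        using r R by (intro nn_integral_mono) (auto simp: indicator_def)
      also have "\<dots> \<le> ennreal (p / 2 * (boundary_term p h f R - boundary_term p h f r) + C * y)"
        unfolding k1_def C_def using y unfolding k2_def
        by (intro compact_interval_estimate[OF \<open>p \<ge> 2\<close> f open_einterval \<open>r \<le> R\<close> sub])
      also have "\<dots> \<le> ennreal (C * Y' + e)"
      proof (rule ennreal_leI)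
        have "p / 2 * (boundary_term p h f R - boundary_term p h f r) \<le> p / 2 * (2 * \<epsilon>)"
          using R(3) r(3) \<open>p \<ge> 2\<close> by (intro mult_left_mono) auto
        moreover have "p / 2 * (2 * \<epsilon>) = e" using \<open>p \<ge> 2\<close> by (simp add: \<epsilon>_def)
        moreover have "C * y \<le> C * Y'" using \<open>y \<le> Y'\<close> C by (intro mult_left_mono) auto
        ultimately show "p / 2 * (boundary_term p h f R - boundary_term p h f r) + C * y \<le> C * Y' + e"
          by linarith
      qed
      also have "\<dots> = ennreal (C * Y') + ennreal e"
        using C Y' \<open>e > 0\<close> by (intro ennreal_plus) auto
      finally show "(\<integral>\<^sup>+x\<in>{c..d}. k1 x * indicator ?Z x \<partial>lborel) \<le> ennreal (C * Y') + ennreal e" .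
    qed
    have meas: "(\<lambda>x. (k1 x * indicator ?Z x) * indicator ?I x) \<in> borel_measurable lborel"
    proof -
      define hb where "hb y = indicator {0<..} y *\<^sub>R h y" for y
      define F where "F x = indicator ?I x *\<^sub>R f x" for x
      define D where "D x = indicator ?I x *\<^sub>R deriv f x" for x
      have hb: "hb \<in> borel_measurable borel"
        unfolding hb_def by (rule borel_measurable_continuous_on_indicator) (auto intro: cont)
      have "continuous_on ?I f"
        using f unfolding W21_loc_def
        by (intro differentiable_imp_continuous_on) (auto simp: differentiable_on_def intro: differentiable_at_withinI)
      then have F: "F \<in> borel_measurable borel"
        unfolding F_def by (intro borel_measurable_continuous_on_indicator) auto
      have D: "D \<in> borel_measurable borel"
        unfolding D_def using f unfolding W21_loc_def
        by (intro borel_measurable_continuous_on_indicator) auto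
      note [measurable] = hb F D
      have eq: "(\<lambda>x. (k1 x * indicator ?Z x) * indicator ?I x) =
          (\<lambda>x. ennreal (\<bar>D x\<bar> powr p * hb \<bar>F x\<bar>))"
        by (rule ext) (auto simp: k1_def hb_def F_def D_def indicator_def)
      show ?thesis unfolding eq by measurable
    qed
    have "(\<integral>\<^sup>+x\<in>?I \<inter> ?Z. k1 x \<partial>lborel) = (\<integral>\<^sup>+x\<in>?I. k1 x * indicator ?Z x \<partial>lborel)"
      by (intro nn_integral_cong) (auto simp: indicator_def)
    also have "\<dots> \<le> ennreal (C * Y')"
      by (rule nn_integral_einterval_le[OF \<open>a < b\<close> meas compact])
    also have "\<dots> = ennreal C * Y" using C Y' by (simp add: ennreal_mult)
    finally show ?thesis .
  qed
  then show ?thesis unfolding Y_def k1_def k2_def C_def .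
qed

end
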